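(* Let $\mathcal N$ be a countable non-standard model of $\mathrm{PA}$ that is the prime model of its complete theory. Then $SR(\mathcal N)=\omega$.
   Context: $SR(\mathcal N)$, the (parameterless) Scott rank, is the least countable ordinal $\alpha$ such that every automorphism orbit of a finite tuple of $\mathcal N$ is definable without parameters by a $\Sigma^{\mathrm{in}}_\alpha$ formula of $L_{\omega_1\omega}$. *)

theory Defs
  imports "HOL-Library.Countable" "HOL-Library.Countable_Set"
begin

section \<open>Countable ordinals\<close>

text \<open>
  A countable ordinal is an order type of a well-order whose field is a set of natural numbers.
  Such relations are reflexive on their field, as everywhere in the library's theory of well-orders.
\<close>

quotient_type countable_ordinal =
  "nat rel" / partial: "\<lambda>r s. Well_order r \<and> Well_order s \<and> (r, s) \<in> ordIso"
proof (rule part_equivpI)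
  show "\<exists>r::nat rel. Well_order r \<and> Well_order r \<and> (r, r) \<in> ordIso"
    using natLeq_Well_order ordIso_reflexive by blast
  show "symp (\<lambda>r s :: nat rel. Well_order r \<and> Well_order s \<and> (r, s) \<in> ordIso)"
    by (auto intro!: sympI ordIso_symmetric)
  show "transp (\<lambda>r s :: nat rel. Well_order r \<and> Well_order s \<and> (r, s) \<in> ordIso)"
    by (auto intro!: transpI intro: ordIso_transitive)
qed

instantiation countable_ordinal :: wellorder
begin

lift_definition less_eq_countable_ordinal :: "countable_ordinal \<Rightarrow> countable_ordinal \<Rightarrow> bool"
  is "\<lambda>r s. (r, s) \<in> ordLeq"
  by (meson ordIso_ordLeq_trans ordIso_symmetric ordLeq_ordIso_trans)

lift_definition less_countable_ordinal :: "countable_ordinal \<Rightarrow> countable_ordinal \<Rightarrow> bool"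
  is "\<lambda>r s. (r, s) \<in> ordLess"
  by (meson ordIso_ordLess_trans ordIso_symmetric ordLess_ordIso_trans)

instance
proof
  fix x y z :: countable_ordinal
  show "x < y \<longleftrightarrow> x \<le> y \<and> \<not> y \<le> x"
    by transfer (meson not_ordLeq_iff_ordLess ordLess_imp_ordLeq)
  show "x \<le> x"
    by transfer (auto intro: ordLeq_reflexive)
  show "x \<le> y \<Longrightarrow> y \<le> z \<Longrightarrow> x \<le> z"
    by transfer (rule ordLeq_transitive)
  show "x \<le> y \<Longrightarrow> y \<le> x \<Longrightarrow> x = y"
    by transfer (auto simp: ordIso_iff_ordLeq)
  show "x \<le> y \<or> y \<le> x"
    by transfer (meson ordLeq_total)
next
  fix P :: "countable_ordinal \<Rightarrow> bool" and a
  assume step: "\<And>x. (\<And>y. y < x \<Longrightarrow> P y) \<Longrightarrow> P x"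
  have "\<forall>x. rep_countable_ordinal x = r \<longrightarrow> P x" for r
  proof (induction r rule: wf_induct_rule[OF wf_ordLess])
    case (1 r)
    show ?case
    proof (intro allI impI)
      fix x assume x: "rep_countable_ordinal x = r"
      show "P x"
      proof (rule step)
        fix y :: countable_ordinal assume "y < x"
        then have "(rep_countable_ordinal y, r) \<in> ordLess"
          using x by (simp add: less_countable_ordinal.rep_eq)
        then show "P y" using 1 by blast
      qed
    qed
  qed
  then show "P a" by blast
qed

end

instantiation countable_ordinal :: zero
begin

lift_definition zero_countable_ordinal :: countable_ordinal is "{} :: nat rel"
  using ordIso_reflexive[of "{} :: nat rel"] by (simp add: well_order_on_empty)

instance ..

end

lift_definition ord_omega :: countable_ordinal ("\<omega>") is natLeq
  using natLeq_Well_order ordIso_reflexive by blast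

lemma countable_ordinal_zero_le: "0 \<le> (x :: countable_ordinal)"
  by transfer (auto simp: ordLeq_def embed_def well_order_on_empty)

section \<open>The language of ordered semirings and its structures\<close>

text \<open>
  The domain of a structure is the whole type \<^typ>\<open>'a\<close>.
\<close>

record 'a arith =
  zro :: 'a
  uno :: 'a
  add :: "'a \<Rightarrow> 'a \<Rightarrow> 'a"
  mul :: "'a \<Rightarrow> 'a \<Rightarrow> 'a"
  lss :: "'a \<Rightarrow> 'a \<Rightarrow> bool"

datatype tm = TVar nat | TZero | TOne | TAdd tm tm | TMul tm tm

primrec tmval :: "'a arith \<Rightarrow> (nat \<Rightarrow> 'a) \<Rightarrow> tm \<Rightarrow> 'a" where
  "tmval M e (TVar x) = e x"
| "tmval M e TZero = zro M"
| "tmval M e TOne = uno M"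
| "tmval M e (TAdd s t) = add M (tmval M e s) (tmval M e t)"
| "tmval M e (TMul s t) = mul M (tmval M e s) (tmval M e t)"

primrec tmvars :: "tm \<Rightarrow> nat set" where
  "tmvars (TVar x) = {x}"
| "tmvars TZero = {}"
| "tmvars TOne = {}"
| "tmvars (TAdd s t) = tmvars s \<union> tmvars t"
| "tmvars (TMul s t) = tmvars s \<union> tmvars t"

definition isomorphism :: "('a \<Rightarrow> 'b) \<Rightarrow> 'a arith \<Rightarrow> 'b arith \<Rightarrow> bool" where
  "isomorphism f M N \<longleftrightarrow> bij f \<and>
     f (zro M) = zro N \<and> f (uno M) = uno N \<and>
     (\<forall>x y. f (add M x y) = add N (f x) (f y)) \<and>
     (\<forall>x y. f (mul M x y) = mul N (f x) (f y)) \<and>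
     (\<forall>x y. lss M x y \<longleftrightarrow> lss N (f x) (f y))"

definition standard_arith :: "nat arith" where
  "standard_arith = \<lparr>zro = 0, uno = 1, add = (+), mul = (*), lss = (<)\<rparr>"

definition nonstandard :: "'a arith \<Rightarrow> bool" where
  "nonstandard N \<longleftrightarrow> \<not> (\<exists>f. isomorphism f standard_arith N)"

section \<open>Finitary first-order logic\<close>

datatype fm = FEq tm tm | FLt tm tm | FNeg fm | FAnd fm fm | FEx nat fm

primrec sat :: "'a arith \<Rightarrow> (nat \<Rightarrow> 'a) \<Rightarrow> fm \<Rightarrow> bool" where
  "sat M e (FEq s t) \<longleftrightarrow> tmval M e s = tmval M e t"
| "sat M e (FLt s t) \<longleftrightarrow> lss M (tmval M e s) (tmval M e t)"
| "sat M e (FNeg p) \<longleftrightarrow> \<not> sat M e p"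
| "sat M e (FAnd p q) \<longleftrightarrow> sat M e p \<and> sat M e q"
| "sat M e (FEx x p) \<longleftrightarrow> (\<exists>a. sat M (e(x := a)) p)"

primrec fv :: "fm \<Rightarrow> nat set" where
  "fv (FEq s t) = tmvars s \<union> tmvars t"
| "fv (FLt s t) = tmvars s \<union> tmvars t"
| "fv (FNeg p) = fv p"
| "fv (FAnd p q) = fv p \<union> fv q"
| "fv (FEx x p) = fv p - {x}"

definition complete_theory :: "'a arith \<Rightarrow> fm set" where
  "complete_theory N = {p. fv p = {} \<and> (\<forall>e. sat N e p)}"

definition models :: "'a arith \<Rightarrow> fm set \<Rightarrow> bool" where
  "models M T \<longleftrightarrow> (\<forall>p\<in>T. \<forall>e. sat M e p)"

definition elementary_embedding :: "('a \<Rightarrow> 'b) \<Rightarrow> 'a arith \<Rightarrow> 'b arith \<Rightarrow> bool" where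
  "elementary_embedding f N M \<longleftrightarrow> (\<forall>p e. sat N e p \<longleftrightarrow> sat M (f \<circ> e) p)"

text \<open>
  A prime model embeds elementarily into every model of its complete theory.  A definition cannot
  quantify over the types of the target models; it suffices to let the target range over the
  structures with domain \<^typ>\<open>nat\<close>, that is (up to isomorphism) over the countably infinite ones.
  By the downward Loewenheim-Skolem theorem this is no restriction: see \<open>prime_model_embeds\<close> below
  for infinite targets.  (If a target is finite, it is isomorphic to \<open>N\<close>.)
\<close>

definition prime_model :: "'a arith \<Rightarrow> bool" where
  "prime_model N \<longleftrightarrow>
     (\<forall>M :: nat arith. models M (complete_theory N) \<longrightarrow> (\<exists>f. elementary_embedding f N M))"

section \<open>Peano arithmetic\<close>

text \<open>
  The axioms of discretely ordered semirings, and the induction scheme.  In the scheme, \<open>p\<close> is an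
  arbitrary first-order formula, \<open>x\<close> the induction variable, and the assignment \<open>e\<close> supplies
  the values of the parameters.
\<close>

definition PA_minus :: "'a arith \<Rightarrow> bool" where
  "PA_minus M \<longleftrightarrow>
     (\<forall>x y z. add M (add M x y) z = add M x (add M y z)) \<and>
     (\<forall>x y. add M x y = add M y x) \<and>
     (\<forall>x y z. mul M (mul M x y) z = mul M x (mul M y z)) \<and>
     (\<forall>x y. mul M x y = mul M y x) \<and>
     (\<forall>x y z. mul M x (add M y z) = add M (mul M x y) (mul M x z)) \<and>
     (\<forall>x. add M x (zro M) = x \<and> mul M x (zro M) = zro M) \<and>
     (\<forall>x. mul M x (uno M) = x) \<and>
     (\<forall>x y z. lss M x y \<and> lss M y z \<longrightarrow> lss M x z) \<and>
     (\<forall>x. \<not> lss M x x) \<and>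
     (\<forall>x y. lss M x y \<or> x = y \<or> lss M y x) \<and>
     (\<forall>x y z. lss M x y \<longrightarrow> lss M (add M x z) (add M y z)) \<and>
     (\<forall>x y z. lss M (zro M) z \<and> lss M x y \<longrightarrow> lss M (mul M x z) (mul M y z)) \<and>
     (\<forall>x y. lss M x y \<longrightarrow> (\<exists>z. add M x z = y)) \<and>
     lss M (zro M) (uno M) \<and>
     (\<forall>x. lss M (zro M) x \<longrightarrow> uno M = x \<or> lss M (uno M) x) \<and>
     (\<forall>x. zro M = x \<or> lss M (zro M) x)"

definition induction_scheme :: "'a arith \<Rightarrow> bool" where
  "induction_scheme M \<longleftrightarrow>
     (\<forall>p x e. sat M (e(x := zro M)) p \<and>
        (\<forall>a. sat M (e(x := a)) p \<longrightarrow> sat M (e(x := add M a (uno M))) p) \<longrightarrow>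
        (\<forall>a. sat M (e(x := a)) p))"

definition models_PA :: "'a arith \<Rightarrow> bool" where
  "models_PA M \<longleftrightarrow> PA_minus M \<and> induction_scheme M"

lemma standard_models_PA: "models_PA standard_arith"
proof -
  have "PA_minus standard_arith"
    by (auto simp: PA_minus_def standard_arith_def algebra_simps) presburger
  moreover have "induction_scheme standard_arith"
    unfolding induction_scheme_def
  proof (intro allI impI, elim conjE)
    fix p x e a
    assume 0: "sat standard_arith (e(x := zro standard_arith)) p"
      and S: "\<forall>a. sat standard_arith (e(x := a)) p \<longrightarrow>
                sat standard_arith (e(x := add standard_arith a (uno standard_arith))) p"
    have ops: "zro standard_arith = 0" "add standard_arith b (uno standard_arith) = Suc b" for b
      by (simp_all add: standard_arith_def)
    show "sat standard_arith (e(x := a)) p"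
    proof (induction a)
      case 0
      show ?case using \<open>sat standard_arith (e(x := zro standard_arith)) p\<close> by (simp only: ops)
    next
      case (Suc a)
      then show ?case using S by (simp only: ops)
    qed
  qed
  ultimately show ?thesis by (simp add: models_PA_def)
qed

section \<open>The infinitary logic and its hierarchy of formulas\<close>

text \<open>
  \<open>IConj I F\<close> and \<open>IDisj I F\<close> are the conjunction and the disjunction of the countable
  family \<open>(F i)\<close> with \<open>i \<in> I\<close>; the values of \<open>F\<close> outside \<open>I\<close> are irrelevant, and
  \<open>I\<close> may be finite or empty.
\<close>

datatype infm =
    IEq tm tm
  | ILt tm tm
  | INeg infm
  | IConj "nat set" "nat \<Rightarrow> infm"
  | IDisj "nat set" "nat \<Rightarrow> infm"
  | IEx nat infm
  | IAll nat infm

primrec isat :: "'a arith \<Rightarrow> infm \<Rightarrow> (nat \<Rightarrow> 'a) \<Rightarrow> bool" where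
  "isat M (IEq s t) = (\<lambda>e. tmval M e s = tmval M e t)"
| "isat M (ILt s t) = (\<lambda>e. lss M (tmval M e s) (tmval M e t))"
| "isat M (INeg p) = (\<lambda>e. \<not> isat M p e)"
| "isat M (IConj I F) = (\<lambda>e. \<forall>i\<in>I. isat M (F i) e)"
| "isat M (IDisj I F) = (\<lambda>e. \<exists>i\<in>I. isat M (F i) e)"
| "isat M (IEx x p) = (\<lambda>e. \<exists>a. isat M p (e(x := a)))"
| "isat M (IAll x p) = (\<lambda>e. \<forall>a. isat M p (e(x := a)))"

primrec ifv :: "infm \<Rightarrow> nat set" where
  "ifv (IEq s t) = tmvars s \<union> tmvars t"
| "ifv (ILt s t) = tmvars s \<union> tmvars t"
| "ifv (INeg p) = ifv p"
| "ifv (IConj I F) = (\<Union>i\<in>I. ifv (F i))"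
| "ifv (IDisj I F) = (\<Union>i\<in>I. ifv (F i))"
| "ifv (IEx x p) = ifv p - {x}"
| "ifv (IAll x p) = ifv p - {x}"

text \<open>Finitary quantifier-free formulas.\<close>

inductive qf :: "infm \<Rightarrow> bool" where
  "qf (IEq s t)"
| "qf (ILt s t)"
| "qf p \<Longrightarrow> qf (INeg p)"
| "finite I \<Longrightarrow> (\<And>i. i \<in> I \<Longrightarrow> qf (F i)) \<Longrightarrow> qf (IConj I F)"
| "finite I \<Longrightarrow> (\<And>i. i \<in> I \<Longrightarrow> qf (F i)) \<Longrightarrow> qf (IDisj I F)"

text \<open>
  For \<open>\<alpha> = 0\<close> both classes consist of the finitary quantifier-free formulas.  For \<open>\<alpha> > 0\<close>, a
  \<open>\<Sigma>\<close>-formula of level \<open>\<alpha>\<close> is a countable disjunction of formulas \<open>\<exists>y\<^sub>1\<dots>y\<^sub>k. q\<close>, where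
  each \<open>q\<close> is a \<open>\<Pi>\<close>-formula of some level below \<open>\<alpha>\<close>; dually for \<open>\<Pi>\<close>.
\<close>

inductive Sigma_in :: "countable_ordinal \<Rightarrow> infm \<Rightarrow> bool"
  and Pi_in :: "countable_ordinal \<Rightarrow> infm \<Rightarrow> bool" where
  "qf p \<Longrightarrow> Sigma_in 0 p"
| "qf p \<Longrightarrow> Pi_in 0 p"
| "0 < \<alpha> \<Longrightarrow> (\<And>i. i \<in> I \<Longrightarrow> \<exists>ys q \<beta>. F i = foldr IEx ys q \<and> \<beta> < \<alpha> \<and> Pi_in \<beta> q)
   \<Longrightarrow> Sigma_in \<alpha> (IDisj I F)"
| "0 < \<alpha> \<Longrightarrow> (\<And>i. i \<in> I \<Longrightarrow> \<exists>ys q \<beta>. F i = foldr IAll ys q \<and> \<beta> < \<alpha> \<and> Sigma_in \<beta> q)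
   \<Longrightarrow> Pi_in \<alpha> (IConj I F)"

section \<open>Scott rank\<close>

definition automorphism_orbit :: "'a arith \<Rightarrow> 'a list \<Rightarrow> 'a list set" where
  "automorphism_orbit N a = {map f a | f. isomorphism f N N}"

text \<open>
  A parameter-free definition of an \<open>n\<close>-ary relation is a formula with free variables among
  \<open>0, \<dots>, n - 1\<close>, where the variable \<open>i\<close> stands for the \<open>i\<close>-th component.
\<close>

definition Sigma_definable :: "'a arith \<Rightarrow> countable_ordinal \<Rightarrow> nat \<Rightarrow> 'a list set \<Rightarrow> bool" where
  "Sigma_definable N \<alpha> n X \<longleftrightarrow>
     (\<exists>p. Sigma_in \<alpha> p \<and> ifv p \<subseteq> {..<n} \<and> (\<forall>e. map e [0..<n] \<in> X \<longleftrightarrow> isat N p e))"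

definition orbits_Sigma_definable :: "'a arith \<Rightarrow> countable_ordinal \<Rightarrow> bool" where
  "orbits_Sigma_definable N \<alpha> \<longleftrightarrow>
     (\<forall>a. Sigma_definable N \<alpha> (length a) (automorphism_orbit N a))"

definition is_scott_rank :: "'a arith \<Rightarrow> countable_ordinal \<Rightarrow> bool" where
  "is_scott_rank N \<alpha> \<longleftrightarrow>
     orbits_Sigma_definable N \<alpha> \<and> (\<forall>\<beta>. orbits_Sigma_definable N \<beta> \<longrightarrow> \<alpha> \<le> \<beta>)"

section \<open>Prime models embed into models over arbitrary types\<close>

instance tm :: countable by countable_datatype
instance fm :: countable by countable_datatype

lemma finite_tmvars: "finite (tmvars t)"
  by (induction t) auto

lemma finite_fv: "finite (fv p)"
  by (induction p) (auto simp: finite_tmvars)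

lemma tmval_cong: "(\<And>x. x \<in> tmvars t \<Longrightarrow> e x = e' x) \<Longrightarrow> tmval M e t = tmval M e' t"
  by (induction t) auto

lemma sat_cong: "(\<And>x. x \<in> fv p \<Longrightarrow> e x = e' x) \<Longrightarrow> sat M e p \<longleftrightarrow> sat M e' p"
proof (induction p arbitrary: e e')
  case (FEx x p)
  have "sat M (e(x := a)) p \<longleftrightarrow> sat M (e'(x := a)) p" for a
    by (rule FEx.IH) (use FEx.prems in auto)
  then show ?case by simp
next
  case (FEq s t)
  then show ?case using tmval_cong[of s e e' M] tmval_cong[of t e e' M] by auto
next
  case (FLt s t)
  then show ?case using tmval_cong[of s e e' M] tmval_cong[of t e e' M] by auto
next
  case (FNeg p)
  then show ?case by (metis fv.simps(3) sat.simps(3))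
next
  case (FAnd p q)
  then show ?case by (metis Un_iff fv.simps(4) sat.simps(4))
qed

lemma elementary_nat_substructure:
  fixes M :: "'b arith"
  assumes inf: "infinite (UNIV :: 'b set)"
  obtains M' :: "nat arith" and g where "elementary_embedding g M' M"
proof -
  define env where "env l = (\<lambda>i. if i < length l then l ! i else zro M)" for l
  define w where "w = (\<lambda>(p, x, l). SOME a. sat M ((env l)(x := a)) p)"
  obtain A0 :: "'b set" where A0: "countable A0" "infinite A0"
    using infinite_countable_subset'[OF inf] by blast
  define A where "A = rec_nat A0 (\<lambda>_ B. B \<union> w ` (UNIV \<times> UNIV \<times> lists B))"
  have A_Suc: "A (Suc n) = A n \<union> w ` (UNIV \<times> UNIV \<times> lists (A n))" for n
    by (simp add: A_def)
  have A_0: "A 0 = A0" by (simp add: A_def)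
  have cA: "countable (A n)" for n
    by (induction n) (auto simp: A_0 A_Suc A0 intro!: countable_SIGMA countable_lists)
  define B where "B = (\<Union>n. A n)"
  have cB: "countable B" unfolding B_def using cA by blast
  have iB: "infinite B" unfolding B_def using A0(2) A_0
    by (metis UN_upper UNIV_I infinite_super)
  have mono: "A m \<subseteq> A n" if "m \<le> n" for m n
    using that by (induction n rule: dec_induct) (auto simp: A_Suc)
  have lB: "\<exists>n. l \<in> lists (A n)" if "l \<in> lists B" for l
    using that
  proof (induction l)
    case (Cons a l)
    then obtain n where n: "l \<in> lists (A n)" by auto
    from Cons obtain m where m: "a \<in> A m" by (auto simp: B_def)
    have "a # l \<in> lists (A (max m n))"
      using n m mono[of m "max m n"] mono[of n "max m n"] by auto
    then show ?case by blast
  qed auto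
  have wB: "w (p, x, l) \<in> B" if "l \<in> lists B" for p x l
  proof -
    obtain n where "l \<in> lists (A n)" using lB[OF \<open>l \<in> lists B\<close>] by blast
    then have "w (p, x, l) \<in> A (Suc n)" by (auto simp: A_Suc)
    then show ?thesis by (auto simp: B_def)
  qed
  have wit: "\<exists>a\<in>B. sat M (e(x := a)) p" if e: "\<And>i. e i \<in> B" and ex: "sat M (e(x := c)) p" for e x p c
  proof -
    obtain k where k: "fv p \<subseteq> {..<k}"
      using finite_fv[of p] finite_nat_bounded by blast
    define l where "l = map e [0..<k]"
    have l: "l \<in> lists B" using e by (auto simp: l_def)
    have eq: "sat M (e(x := a)) p \<longleftrightarrow> sat M ((env l)(x := a)) p" for a
      by (rule sat_cong) (use k in \<open>auto simp: env_def l_def\<close>)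
    have "sat M ((env l)(x := w (p, x, l))) p"
      unfolding w_def prod.case by (rule someI[of _ c]) (use ex eq in blast)
    then show ?thesis using wB[OF l] eq by blast
  qed
  define g where "g = from_nat_into B"
  define h where "h = to_nat_on B"
  have g: "g i \<in> B" for i
    unfolding g_def using iB by (metis finite.emptyI from_nat_into)
  have gh: "g (h b) = b" if "b \<in> B" for b
    unfolding g_def h_def using cB that by simp
  obtain b0 where b0: "b0 \<in> B" using g by blast
  have tB: "tmval M e t \<in> B" if e: "\<And>i. e i \<in> B" for e t
  proof -
    obtain x where x: "x \<notin> tmvars t"
      using finite_tmvars[of t] ex_new_if_finite infinite_UNIV_nat by blast
    have t: "tmval M (e(x := a)) t = tmval M e t" for a
      by (rule tmval_cong) (use x in auto)
    have "\<exists>a\<in>B. sat M (e(x := a)) (FEq (TVar x) t)"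
      by (rule wit[OF e, where c = "tmval M e t"]) (simp add: t)
    then show ?thesis by (simp add: t)
  qed
  have zB: "zro M \<in> B" "uno M \<in> B"
    using tB[of "\<lambda>_. b0" TZero] tB[of "\<lambda>_. b0" TOne] b0 by auto
  have opB: "add M a b \<in> B" "mul M a b \<in> B" if "a \<in> B" "b \<in> B" for a b
    using tB[of "\<lambda>i. if i = 0 then a else b" "TAdd (TVar 0) (TVar 1)"]
      tB[of "\<lambda>i. if i = 0 then a else b" "TMul (TVar 0) (TVar 1)"] that by auto
  define M' where "M' = \<lparr>zro = h (zro M), uno = h (uno M),
    add = (\<lambda>i j. h (add M (g i) (g j))), mul = (\<lambda>i j. h (mul M (g i) (g j))),
    lss = (\<lambda>i j. lss M (g i) (g j))\<rparr>"
  have inj: "g i = g j \<longleftrightarrow> i = j" for i j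
    unfolding g_def using cB iB by (simp add: from_nat_into_inj_infinite)
  have tm: "g (tmval M' e t) = tmval M (g \<circ> e) t" for e t
    by (induction t) (simp_all add: M'_def gh zB opB tB g)
  have "sat M' e p \<longleftrightarrow> sat M (g \<circ> e) p" for p e
  proof (induction p arbitrary: e)
    case (FEq s t)
    show ?case by (simp only: sat.simps tm[symmetric] inj)
  next
    case (FLt s t)
    show ?case by (simp only: sat.simps tm[symmetric]) (simp add: M'_def)
  next
    case (FEx x p)
    have upd: "g \<circ> e(x := i) = (g \<circ> e)(x := g i)" for i by auto
    show ?case
    proof
      assume "sat M' e (FEx x p)"
      then show "sat M (g \<circ> e) (FEx x p)" by (metis FEx.IH upd sat.simps(5))
    next
      assume "sat M (g \<circ> e) (FEx x p)"
      then obtain c where "sat M ((g \<circ> e)(x := c)) p" by auto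
      then obtain a where a: "a \<in> B" "sat M ((g \<circ> e)(x := a)) p"
        using wit[of "g \<circ> e" x c p] g by auto
      then have "sat M' (e(x := h a)) p" by (metis FEx.IH upd gh)
      then show "sat M' e (FEx x p)" by (metis sat.simps(5))
    qed
  qed auto
  then have "elementary_embedding g M' M" by (simp add: elementary_embedding_def)
  then show ?thesis using that by blast
qed

lemma prime_model_embeds:
  fixes N :: "'a arith" and M :: "'b arith"
  assumes "prime_model N" and M: "models M (complete_theory N)"
    and "infinite (UNIV :: 'b set)"
  shows "\<exists>f. elementary_embedding f N M"
proof -
  obtain M' :: "nat arith" and g where g: "elementary_embedding g M' M"
    using elementary_nat_substructure[OF assms(3)] by blast
  have "models M' (complete_theory N)"
    using M g by (auto simp: models_def elementary_embedding_def)
  then obtain f where f: "elementary_embedding f N M'"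
    using assms(1) by (auto simp: prime_model_def)
  have "elementary_embedding (g \<circ> f) N M"
    using f g by (simp add: elementary_embedding_def o_assoc)
  then show ?thesis by blast
qed

end

theory Submission
  imports Defs
begin

text \<open>
  Every element of a prime model of Peano arithmetic is definable: by the least number principle
  the definable elements form an elementary submodel, into which the prime model embeds
  elementarily, and an elementary embedding fixes every element whose value is definable.  Hence
  every orbit is a singleton, defined by a finitary formula, and such a formula has a finite level.

  For the lower bound, elements of the model are read as codes of finite sequences by means of
  Goedel's beta function.  Consider the Ehrenfeucht-Fraisse game of \<open>n\<close> rounds in which the players
  pick codes and the final position is compared only on the atomic relations between entries with
  index below \<open>k\<close>.  The winning condition is first-order in \<open>k\<close>.  For standard \<open>k\<close> there are
  finitely many classes of positions, so two distinct elements are equivalent; by overspill this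
  happens for some nonstandard \<open>k\<close> too.  At a nonstandard \<open>k\<close> all entries of standard index are
  compared, so that a move handles a block of quantifiers of arbitrary finite length and equivalent
  elements satisfy the same infinitary formulas of the corresponding finite level.
\<close>

section \<open>The finite ordinals as the initial segment below \<omega>\<close>

lift_definition fin_ord :: "nat \<Rightarrow> countable_ordinal" is natLeq_on
  by (rule conjI[OF natLeq_on_Well_order conjI[OF natLeq_on_Well_order ordIso_reflexive[OF natLeq_on_Well_order]]])

text \<open>A well-order is smaller than another when it is isomorphic to the restriction of the
  other to the predecessors of some point; here the point is \<open>m\<close>.\<close>

lemma fin_ord_less: "fin_ord m < fin_ord n" if "m < n"
  using that
proof transfer
  fix m n :: nat assume mn: "m < n"
  have "Restr (natLeq_on n) (underS (natLeq_on n) m) = natLeq_on m"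
    using mn by (auto simp: underS_def)
  then have "(natLeq_on m, Restr (natLeq_on n) (underS (natLeq_on n) m)) \<in> ordIso"
    by (simp only: ordIso_reflexive[OF natLeq_on_Well_order])
  moreover have "m \<in> Field (natLeq_on n)" using mn by (simp only: Field_natLeq_on mem_Collect_eq)
  ultimately show "(natLeq_on m, natLeq_on n) \<in> ordLess"
    by (rule iffD2[OF ordLess_iff_ordIso_Restr[OF natLeq_on_Well_order natLeq_on_Well_order] bexI])
qed

lemma less_fin_ord_iff: "fin_ord m < fin_ord n \<longleftrightarrow> m < n"
  by (metis fin_ord_less less_asym' linorder_neqE_nat order.strict_implies_not_eq)

text \<open>The proper initial segments of \<open>natLeq\<close> are the relations
  \<open>natLeq_on a\<close>. Under \<open>transfer\<close>, equality of ordinals becomes order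
  isomorphism.\<close>

lemma less_omega_iff: "\<beta> < \<omega> \<longleftrightarrow> (\<exists>n. \<beta> = fin_ord n)"
proof transfer
  fix r :: "nat rel"
  assume r: "Well_order r \<and> Well_order r \<and> (r, r) \<in> ordIso"
  have "(r, natLeq) \<in> ordLess \<longleftrightarrow> (\<exists>a. (r, natLeq_on a) \<in> ordIso)"
    using r ordLess_iff_ordIso_Restr[OF natLeq_Well_order, of r] by (simp add: Restr_natLeq2 Field_natLeq)
  then show "((r, natLeq) \<in> ordLess) = (\<exists>n. Well_order r \<and> Well_order (natLeq_on n) \<and> (r, natLeq_on n) \<in> ordIso)"
    using r natLeq_on_Well_order by blast
qed

lemma less_fin_ordE:
  assumes "\<gamma> < fin_ord n"
  obtains m where "\<gamma> = fin_ord m" "m < n"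
proof -
  have "fin_ord n < \<omega>" using less_omega_iff by blast
  then have "\<gamma> < \<omega>" using assms by simp
  then show thesis using that assms by (auto simp: less_omega_iff less_fin_ord_iff)
qed

section \<open>Infinitary formulas and back-and-forth systems\<close>

text \<open>The graphs of the operations are compared because \<open>R\<close> need not be closed
  under them. The clause for equality makes \<open>R\<close> the graph of a partial
  injection.\<close>

definition partial_iso :: "'a arith \<Rightarrow> 'a rel \<Rightarrow> bool" where
  "partial_iso N R \<longleftrightarrow> (\<forall>u u' v v' w w'. (u, u') \<in> R \<longrightarrow> (v, v') \<in> R \<longrightarrow> (w, w') \<in> R \<longrightarrow>
     (u = zro N \<longleftrightarrow> u' = zro N) \<and> (u = uno N \<longleftrightarrow> u' = uno N) \<and>
     (u = v \<longleftrightarrow> u' = v') \<and> (lss N u v \<longleftrightarrow> lss N u' v') \<and>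
     (w = add N u v \<longleftrightarrow> w' = add N u' v') \<and> (w = mul N u v \<longleftrightarrow> w' = mul N u' v'))"

lemma partial_isoD:
  assumes "partial_iso N R" "(u, u') \<in> R"
  shows "u = zro N \<longleftrightarrow> u' = zro N" "u = uno N \<longleftrightarrow> u' = uno N"
    "(v, v') \<in> R \<Longrightarrow> u = v \<longleftrightarrow> u' = v'"
    "(v, v') \<in> R \<Longrightarrow> lss N u v \<longleftrightarrow> lss N u' v'"
    "(v, v') \<in> R \<Longrightarrow> (w, w') \<in> R \<Longrightarrow> w = add N u v \<longleftrightarrow> w' = add N u' v'"
    "(v, v') \<in> R \<Longrightarrow> (w, w') \<in> R \<Longrightarrow> w = mul N u v \<longleftrightarrow> w' = mul N u' v'"
proof -
  note * = assms(1)[unfolded partial_iso_def, rule_format, OF assms(2)]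
  show "u = zro N \<longleftrightarrow> u' = zro N" "u = uno N \<longleftrightarrow> u' = uno N"
    using *[OF assms(2) assms(2)] by blast+
  show "u = v \<longleftrightarrow> u' = v'" "lss N u v \<longleftrightarrow> lss N u' v'" if "(v, v') \<in> R"
    using *[OF that that] by blast+
  show "w = add N u v \<longleftrightarrow> w' = add N u' v'" "w = mul N u v \<longleftrightarrow> w' = mul N u' v'"
    if "(v, v') \<in> R" "(w, w') \<in> R"
    using *[OF that] by blast+
qed

text \<open>A round answers a whole finite set rather than one element, since a block of quantifiers
  of any finite length counts as a single level of the hierarchy.\<close>

primrec back_forth :: "'a arith \<Rightarrow> nat \<Rightarrow> 'a rel \<Rightarrow> bool" where
  "back_forth N 0 R \<longleftrightarrow> partial_iso N R"
| "back_forth N (Suc n) R \<longleftrightarrow> (\<forall>C. finite C \<longrightarrow>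
     (\<exists>R'. R \<subseteq> R' \<and> back_forth N n R' \<and> C \<subseteq> Domain R') \<and>
     (\<exists>R'. R \<subseteq> R' \<and> back_forth N n R' \<and> C \<subseteq> Range R'))"

lemma partial_iso_converse: "partial_iso N R \<Longrightarrow> partial_iso N (R\<inverse>)"
  unfolding partial_iso_def converse_iff
proof (intro allI impI, goal_cases)
  case (1 u u' v v' w w')
  from 1(1)[rule_format, OF 1(2-4)] show ?case by blast
qed

lemma partial_iso_antimono: "partial_iso N R \<Longrightarrow> R0 \<subseteq> R \<Longrightarrow> partial_iso N R0"
  unfolding partial_iso_def
proof (intro allI impI, goal_cases)
  case (1 u u' v v' w w')
  from 1(1)[rule_format, OF 1(3-5)[THEN subsetD[OF 1(2)]]] show ?case .
qed

lemma back_forth_converse: "back_forth N n R \<Longrightarrow> back_forth N n (R\<inverse>)"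
proof (induction n arbitrary: R)
  case (Suc n)
  show ?case
    unfolding back_forth.simps
  proof (intro allI impI)
    fix C :: "'a set" assume "finite C"
    then obtain R1 R2 where "R1 \<supseteq> R" "back_forth N n R1" "C \<subseteq> Domain R1"
      "R2 \<supseteq> R" "back_forth N n R2" "C \<subseteq> Range R2"
      using Suc.prems by (metis back_forth.simps(2))
    then have "R2\<inverse> \<supseteq> R\<inverse> \<and> back_forth N n (R2\<inverse>) \<and> C \<subseteq> Domain (R2\<inverse>)"
      "R1\<inverse> \<supseteq> R\<inverse> \<and> back_forth N n (R1\<inverse>) \<and> C \<subseteq> Range (R1\<inverse>)"
      using Suc.IH by auto
    then show "(\<exists>R'. R\<inverse> \<subseteq> R' \<and> back_forth N n R' \<and> C \<subseteq> Domain R') \<and>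
      (\<exists>R'. R\<inverse> \<subseteq> R' \<and> back_forth N n R' \<and> C \<subseteq> Range R')" by blast
  qed
qed (simp add: partial_iso_converse)

lemma back_forth_antimono: "back_forth N n R \<Longrightarrow> R0 \<subseteq> R \<Longrightarrow> back_forth N n R0"
  by (cases n) (simp_all add: partial_iso_antimono, meson order.trans)

text \<open>A challenge by the empty set yields an extension of lower rank, and rank passes to
  subrelations.\<close>

lemma back_forth_SucD: "back_forth N (Suc n) R \<Longrightarrow> back_forth N n R"
  using back_forth_antimono by (metis back_forth.simps(2) finite.emptyI)

lemma back_forth_le: "back_forth N n R \<Longrightarrow> m \<le> n \<Longrightarrow> back_forth N m R"
  by (induction n) (use back_forth_SucD le_Suc_eq in blast)+

section \<open>Terms and quantifier-free formulas under partial isomorphisms\<close>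

primrec subtms :: "tm \<Rightarrow> tm set" where
  "subtms (TVar x) = {TVar x}"
| "subtms TZero = {TZero}"
| "subtms TOne = {TOne}"
| "subtms (TAdd s t) = insert (TAdd s t) (subtms s \<union> subtms t)"
| "subtms (TMul s t) = insert (TMul s t) (subtms s \<union> subtms t)"

lemma finite_subtms: "finite (subtms t)"
  by (induction t) auto

text \<open>By induction on the term: the value of each subterm already has a partner in
  \<open>R\<close>, and the comparison of graphs identifies this partner as the value under
  \<open>e'\<close>.\<close>

lemma partial_iso_tmval:
  assumes "partial_iso N R" and "\<And>x. x \<in> tmvars t \<Longrightarrow> (e x, e' x) \<in> R"
    and "tmval N e ` subtms t \<subseteq> Domain R"
  shows "(tmval N e t, tmval N e' t) \<in> R"
  using assms(2,3)
proof (induction t)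
  case TZero
  then show ?case using partial_isoD(1)[OF assms(1)] by (auto simp: Domain_iff)
next
  case TOne
  then show ?case using partial_isoD(2)[OF assms(1)] by (auto simp: Domain_iff)
next
  case (TAdd s t)
  then have s: "(tmval N e s, tmval N e' s) \<in> R" and t: "(tmval N e t, tmval N e' t) \<in> R"
    by (simp_all add: image_Un)
  obtain w where w: "(add N (tmval N e s) (tmval N e t), w) \<in> R" using TAdd.prems by auto
  then have "w = add N (tmval N e' s) (tmval N e' t)"
    using partial_isoD(5)[OF assms(1) s t w] by simp
  then show ?case using w by simp
next
  case (TMul s t)
  then have s: "(tmval N e s, tmval N e' s) \<in> R" and t: "(tmval N e t, tmval N e' t) \<in> R"
    by (simp_all add: image_Un)
  obtain w where w: "(mul N (tmval N e s) (tmval N e t), w) \<in> R" using TMul.prems by auto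
  then have "w = mul N (tmval N e' s) (tmval N e' t)"
    using partial_isoD(6)[OF assms(1) s t w] by simp
  then show ?case using w by simp
qed auto

text \<open>One round brings the values of all subterms into the domain. This is why quantifier-free
  formulas require rank 1 and not rank 0.\<close>

lemma back_forth_tmvals:
  assumes "back_forth N 1 R" and "\<And>x. x \<in> tmvars s \<union> tmvars t \<Longrightarrow> (e x, e' x) \<in> R"
  obtains R' where "partial_iso N R'" "(tmval N e s, tmval N e' s) \<in> R'"
    "(tmval N e t, tmval N e' t) \<in> R'"
proof -
  have "finite (tmval N e ` (subtms s \<union> subtms t))" by (simp add: finite_subtms)
  then obtain R' where R': "R \<subseteq> R'" "partial_iso N R'" "tmval N e ` (subtms s \<union> subtms t) \<subseteq> Domain R'"
    using assms(1) unfolding One_nat_def back_forth.simps by meson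
  then show thesis
    using that[OF R'(2)] partial_iso_tmval[OF R'(2), of s e e'] partial_iso_tmval[OF R'(2), of t e e']
      assms(2) by (auto simp: image_Un)
qed

lemma back_forth_qf:
  assumes "qf p" and R: "back_forth N 1 R" and "\<And>x. x \<in> ifv p \<Longrightarrow> (e x, e' x) \<in> R"
  shows "isat N p e \<longleftrightarrow> isat N p e'"
  using assms(1,3)
proof (induction p)
  case (1 s t)
  obtain R' where "partial_iso N R'" "(tmval N e s, tmval N e' s) \<in> R'"
    "(tmval N e t, tmval N e' t) \<in> R'"
    using back_forth_tmvals[OF R, of s t e e'] 1 by auto
  then show ?case using partial_isoD(3) by fastforce
next
  case (2 s t)
  obtain R' where "partial_iso N R'" "(tmval N e s, tmval N e' s) \<in> R'"
    "(tmval N e t, tmval N e' t) \<in> R'"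
    using back_forth_tmvals[OF R, of s t e e'] 2 by auto
  then show ?case using partial_isoD(4) by fastforce
next
  case (4 I F)
  then have "isat N (F i) e \<longleftrightarrow> isat N (F i) e'" if "i \<in> I" for i using that by auto
  then show ?case by simp
next
  case (5 I F)
  then have "isat N (F i) e \<longleftrightarrow> isat N (F i) e'" if "i \<in> I" for i using that by auto
  then show ?case by simp
qed auto

section \<open>Quantifier blocks and the transfer of infinitary formulas\<close>

lemma isat_foldr_IEx:
  "isat N (foldr IEx ys q) e \<longleftrightarrow> (\<exists>f. isat N q (override_on e f (set ys)))"
proof (induction ys arbitrary: e)
  case (Cons y ys)
  \<comment> \<open>Outside \<open>set ys\<close> only the value at \<open>y\<close> matters, so
    \<open>a\<close> can be the default. If \<open>y\<close> recurs in \<open>ys\<close>, the inner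
    quantifier overrides \<open>a\<close> on both sides.\<close>
  have 1: "override_on (e(y := a)) f (set ys) =
      override_on e (\<lambda>x. if x \<in> set ys then f x else a) (set (y # ys))" for a f
    by (auto simp: override_on_def)
  have 2: "override_on e f (set (y # ys)) = override_on (e(y := f y)) f (set ys)" for f
    by (auto simp: override_on_def)
  show ?case
  proof
    assume "isat N (foldr IEx (y # ys) q) e"
    then obtain a f where "isat N q (override_on (e(y := a)) f (set ys))"
      unfolding foldr.simps o_apply isat.simps Cons.IH by (elim exE)
    then show "\<exists>f. isat N q (override_on e f (set (y # ys)))" unfolding 1 by (intro exI)
  next
    assume "\<exists>f. isat N q (override_on e f (set (y # ys)))"
    then obtain f where "isat N q (override_on (e(y := f y)) f (set ys))" unfolding 2 by (elim exE)
    then show "isat N (foldr IEx (y # ys) q) e"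
      unfolding foldr.simps o_apply isat.simps Cons.IH by (intro exI)
  qed
qed simp

lemma isat_foldr_IAll:
  "isat N (foldr IAll ys q) e \<longleftrightarrow> (\<forall>f. isat N q (override_on e f (set ys)))"
proof -
  have "isat N (foldr IAll ys q) e \<longleftrightarrow> \<not> isat N (foldr IEx ys (INeg q)) e"
    by (induction ys arbitrary: e) auto
  then show ?thesis by (simp add: isat_foldr_IEx)
qed

lemma ifv_foldr: "ifv (foldr IEx ys q) = ifv q - set ys" "ifv (foldr IAll ys q) = ifv q - set ys"
  by (induction ys) auto

text \<open>The values of \<open>f\<close> on the block form the finite challenge of one round;
  outside the block the old pairs persist because \<open>R'\<close> extends
  \<open>R\<close>.\<close>

lemma back_forth_override:
  assumes "back_forth N (Suc n) R" and "\<forall>x\<in>X - set ys. (e x, e' x) \<in> R"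
  shows "\<exists>f' R'. back_forth N n R' \<and>
    (\<forall>x\<in>X. (override_on e f (set ys) x, override_on e' f' (set ys) x) \<in> R')"
proof -
  obtain R' where R': "R \<subseteq> R'" "back_forth N n R'" "f ` set ys \<subseteq> Domain R'"
    using assms(1) unfolding back_forth.simps by (meson finite_imageI finite_set)
  then have "\<forall>x\<in>set ys. \<exists>v. (f x, v) \<in> R'" by auto
  then obtain f' where "\<forall>x\<in>set ys. (f x, f' x) \<in> R'" by metis
  then have "back_forth N n R' \<and>
    (\<forall>x\<in>X. (override_on e f (set ys) x, override_on e' f' (set ys) x) \<in> R')"
    using R'(1,2) assms(2) by (auto simp: override_on_def)
  then show ?thesis by (intro exI)
qed

text \<open>Strong induction on the level, with one rank in reserve for the terms of the
  quantifier-free matrix. Only one implication is shown, for all relations of the rank; the other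
  follows by passing to the converse relation.\<close>

lemma back_forth_Sigma_Pi:
  assumes "Sigma_in (fin_ord n) p \<or> Pi_in (fin_ord n) p"
    and "back_forth N (Suc n) R" and "\<And>x. x \<in> ifv p \<Longrightarrow> (e x, e' x) \<in> R"
  shows "isat N p e \<longleftrightarrow> isat N p e'"
  using assms
proof (induction n arbitrary: p R e e' rule: less_induct)
  case (less n)
  have transfer: "isat N p e \<longrightarrow> isat N p e'"
    if R: "back_forth N (Suc n) R" "\<And>x. x \<in> ifv p \<Longrightarrow> (e x, e' x) \<in> R" for R e e'
  proof -
    have qf: ?thesis if "qf p"
      using back_forth_qf[OF that back_forth_le[OF R(1)], of e e'] R(2) by simp
    \<comment> \<open>A component of level \<open>m\<close> needs rank \<open>Suc m\<close>, and
      \<open>m < n\<close> makes this at most \<open>n\<close>, the rank left after the round spent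
      on the block.\<close>
    have below: "isat N q e1 \<longleftrightarrow> isat N q e2"
      if "\<gamma> < fin_ord n" "Sigma_in \<gamma> q \<or> Pi_in \<gamma> q" "back_forth N n R'"
        "\<forall>x\<in>ifv q. (e1 x, e2 x) \<in> R'" for \<gamma> q R' e1 e2
    proof -
      obtain m where m: "\<gamma> = fin_ord m" "m < n" using less_fin_ordE[OF \<open>\<gamma> < fin_ord n\<close>] .
      show ?thesis
        using less.IH[OF m(2), of q R' e1 e2] that m back_forth_le[of N n R' "Suc m"] by auto
    qed
    from less.prems(1) show ?thesis
    proof
      assume "Sigma_in (fin_ord n) p"
      then show ?thesis
      proof cases
        case 1
        then show ?thesis using qf by simp
      next
        case (2 I F)
        show ?thesis
        proof
          assume "isat N p e"
          then obtain i where i: "i \<in> I" "isat N (F i) e" unfolding 2(1) by auto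
          then obtain ys q \<gamma> where q: "F i = foldr IEx ys q" "\<gamma> < fin_ord n" "Pi_in \<gamma> q"
            using 2(3) by blast
          then obtain f where f: "isat N q (override_on e f (set ys))"
            using i(2) unfolding q(1) isat_foldr_IEx by blast
          have "ifv (F i) \<subseteq> ifv p" unfolding 2(1) ifv.simps using i(1) by (rule UN_upper)
          then have "ifv q - set ys \<subseteq> ifv p" by (simp only: q(1) ifv_foldr)
          then have *: "\<forall>x\<in>ifv q - set ys. (e x, e' x) \<in> R" using R(2) by blast
          from back_forth_override[of N n R "ifv q" ys e e' f, OF R(1) *]
          obtain f' R' where R': "back_forth N n R' \<and>
            (\<forall>x\<in>ifv q. (override_on e f (set ys) x, override_on e' f' (set ys) x) \<in> R')"
            by (elim exE)
          then have "isat N q (override_on e' f' (set ys))"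
            using f below[OF q(2) disjI2[OF q(3)] conjunct1[OF R'] conjunct2[OF R']] by simp
          then have "isat N (F i) e'" unfolding q(1) isat_foldr_IEx by blast
          then show "isat N p e'" unfolding 2(1) using i by auto
        qed
      qed
    next
      assume "Pi_in (fin_ord n) p"
      then show ?thesis
      proof cases
        case 1
        then show ?thesis using qf by simp
      next
        case (2 I F)
        show ?thesis
        proof
          assume p: "isat N p e"
          have "isat N (F i) e'" if i: "i \<in> I" for i
          proof -
            obtain ys q \<gamma> where q: "F i = foldr IAll ys q" "\<gamma> < fin_ord n" "Sigma_in \<gamma> q"
              using 2(3) i by blast
            have "ifv (F i) \<subseteq> ifv p" unfolding 2(1) ifv.simps using i by (rule UN_upper)
            then have sub: "ifv q - set ys \<subseteq> ifv p" by (simp only: q(1) ifv_foldr)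
            have "isat N q (override_on e' f' (set ys))" for f'
            proof -
              \<comment> \<open>The challenge \<open>f'\<close> arises on the side of
                \<open>e'\<close>, so it is answered through the converse relation on the side of
                \<open>e\<close>, where \<open>p\<close> is known to hold.\<close>
              have *: "\<forall>x\<in>ifv q - set ys. (e' x, e x) \<in> R\<inverse>" using R(2) sub by blast
              from back_forth_override[of N n "R\<inverse>" "ifv q" ys e' e f',
                  OF back_forth_converse[OF R(1)] *]
              obtain f R' where R': "back_forth N n R' \<and>
                (\<forall>x\<in>ifv q. (override_on e' f' (set ys) x, override_on e f (set ys) x) \<in> R')"
                by (elim exE)
              moreover have "isat N q (override_on e f (set ys))"
                using p i isat_foldr_IAll[of N ys q e, folded q(1)] unfolding 2(1) by simp
              ultimately show ?thesis
                using below[OF q(2) disjI1[OF q(3)] conjunct1[OF R'] conjunct2[OF R']] by simp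
            qed
            then show ?thesis using q(1) by (simp add: isat_foldr_IAll)
          qed
          then show "isat N p e'" unfolding 2(1) by simp
        qed
      qed
    qed
  qed
  show ?case
    using transfer[OF less.prems(2), of e e'] transfer[OF back_forth_converse[OF less.prems(2)], of e' e]
      less.prems(3) by blast
qed

section \<open>Finitary formulas in the infinitary hierarchy\<close>

definition expressible :: "'a arith \<Rightarrow> (infm \<Rightarrow> bool) \<Rightarrow> nat set \<Rightarrow> ((nat \<Rightarrow> 'a) \<Rightarrow> bool) \<Rightarrow> bool" where
  "expressible N \<Phi> V P \<longleftrightarrow> (\<exists>q. \<Phi> q \<and> ifv q \<subseteq> V \<and> (\<forall>e. isat N q e \<longleftrightarrow> P e))"

text \<open>A disjunction with the single index 0. With an empty block it turns a \<Pi>-formula into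
  a \<Sigma>-formula of any higher level.\<close>

lemma expressible_Sigma_Ex:
  assumes "expressible N (Pi_in \<beta>) V P" "\<beta> < \<alpha>"
  shows "expressible N (Sigma_in \<alpha>) (V - set xs) (\<lambda>e. \<exists>f. P (override_on e f (set xs)))"
proof -
  obtain q where q: "Pi_in \<beta> q" "ifv q \<subseteq> V" "\<And>e. isat N q e \<longleftrightarrow> P e"
    using assms(1) by (auto simp: expressible_def)
  have "0 < \<alpha>" using assms(2) countable_ordinal_zero_le[of \<beta>] by simp
  then have "Sigma_in \<alpha> (IDisj {0} (\<lambda>_. foldr IEx xs q))"
    using q(1) assms(2) by (intro Sigma_in_Pi_in.intros) auto
  moreover have "ifv (IDisj {0} (\<lambda>_. foldr IEx xs q)) \<subseteq> V - set xs"
    using q(2) by (auto simp: ifv_foldr)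
  ultimately show ?thesis
    unfolding expressible_def by (rule_tac exI conjI)+ (auto simp: isat_foldr_IEx q(3))
qed

lemma expressible_Pi_All:
  assumes "expressible N (Sigma_in \<beta>) V P" "\<beta> < \<alpha>"
  shows "expressible N (Pi_in \<alpha>) (V - set xs) (\<lambda>e. \<forall>f. P (override_on e f (set xs)))"
proof -
  obtain q where q: "Sigma_in \<beta> q" "ifv q \<subseteq> V" "\<And>e. isat N q e \<longleftrightarrow> P e"
    using assms(1) by (auto simp: expressible_def)
  have "0 < \<alpha>" using assms(2) countable_ordinal_zero_le[of \<beta>] by simp
  then have "Pi_in \<alpha> (IConj {0} (\<lambda>_. foldr IAll xs q))"
    using q(1) assms(2) by (intro Sigma_in_Pi_in.intros) auto
  moreover have "ifv (IConj {0} (\<lambda>_. foldr IAll xs q)) \<subseteq> V - set xs"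
    using q(2) by (auto simp: ifv_foldr)
  ultimately show ?thesis
    unfolding expressible_def by (rule_tac exI conjI)+ (auto simp: isat_foldr_IAll q(3))
qed

lemmas expressible_Sigma = expressible_Sigma_Ex[where xs = "[]", simplified]
lemmas expressible_Pi = expressible_Pi_All[where xs = "[]", simplified]

lemma expressible_Sigma_Or:
  assumes "expressible N (Pi_in \<beta>) V P" "expressible N (Pi_in \<beta>) W Q" "\<beta> < \<alpha>"
  shows "expressible N (Sigma_in \<alpha>) (V \<union> W) (\<lambda>e. P e \<or> Q e)"
proof -
  obtain p q where p: "Pi_in \<beta> p" "ifv p \<subseteq> V" "\<And>e. isat N p e \<longleftrightarrow> P e"
    and q: "Pi_in \<beta> q" "ifv q \<subseteq> W" "\<And>e. isat N q e \<longleftrightarrow> Q e"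
    using assms(1,2) unfolding expressible_def by metis
  have "0 < \<alpha>" using assms(3) countable_ordinal_zero_le[of \<beta>] by simp
  moreover have "\<exists>ys r \<beta>. (if i = 0 then p else q) = foldr IEx ys r \<and> \<beta> < \<alpha> \<and> Pi_in \<beta> r"
    for i :: nat
    by (rule exI[of _ "[]"]) (use p(1) q(1) assms(3) in auto)
  ultimately have "Sigma_in \<alpha> (IDisj {0, 1} (\<lambda>i. if i = 0 then p else q))"
    by (intro Sigma_in_Pi_in.intros)
  then show ?thesis
    unfolding expressible_def
    by (intro exI[of _ "IDisj {0, 1} (\<lambda>i. if i = 0 then p else q)"])
      (use p(2,3) q(2,3) in \<open>auto split: if_splits\<close>)
qed

lemma expressible_Pi_And:
  assumes "expressible N (Sigma_in \<beta>) V P" "expressible N (Sigma_in \<beta>) W Q" "\<beta> < \<alpha>"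
  shows "expressible N (Pi_in \<alpha>) (V \<union> W) (\<lambda>e. P e \<and> Q e)"
proof -
  obtain p q where p: "Sigma_in \<beta> p" "ifv p \<subseteq> V" "\<And>e. isat N p e \<longleftrightarrow> P e"
    and q: "Sigma_in \<beta> q" "ifv q \<subseteq> W" "\<And>e. isat N q e \<longleftrightarrow> Q e"
    using assms(1,2) unfolding expressible_def by metis
  have "0 < \<alpha>" using assms(3) countable_ordinal_zero_le[of \<beta>] by simp
  moreover have "\<exists>ys r \<beta>. (if i = 0 then p else q) = foldr IAll ys r \<and> \<beta> < \<alpha> \<and> Sigma_in \<beta> r"
    for i :: nat
    by (rule exI[of _ "[]"]) (use p(1) q(1) assms(3) in auto)
  ultimately have "Pi_in \<alpha> (IConj {0, 1} (\<lambda>i. if i = 0 then p else q))"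
    by (intro Sigma_in_Pi_in.intros)
  then show ?thesis
    unfolding expressible_def
    by (intro exI[of _ "IConj {0, 1} (\<lambda>i. if i = 0 then p else q)"])
      (use p(2,3) q(2,3) in \<open>auto split: if_splits\<close>)
qed

lemma expressible_qf:
  assumes "qf q" "ifv q \<subseteq> V" "\<And>e. isat N q e \<longleftrightarrow> P e"
  shows "expressible N (Sigma_in \<alpha>) V P" "expressible N (Pi_in \<alpha>) V P"
proof -
  have 0: "expressible N (Sigma_in 0) V P" "expressible N (Pi_in 0) V P"
    using assms Sigma_in_Pi_in.intros(1,2) unfolding expressible_def by blast+
  have "\<alpha> = 0 \<or> 0 < \<alpha>" using countable_ordinal_zero_le[of \<alpha>] by auto
  then show "expressible N (Sigma_in \<alpha>) V P" "expressible N (Pi_in \<alpha>) V P"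
    using 0 expressible_Sigma[OF 0(2)] expressible_Pi[OF 0(1)] by auto
qed

text \<open>At positive levels \<open>Sigma_in\<close> has only disjunctions and
  \<open>Pi_in\<close> only conjunctions, so the classes are not literally cumulative. Asking for
  both classes at all levels from \<open>n\<close> on lets two formulas be brought to a common
  level.\<close>

definition expressible_from :: "'a arith \<Rightarrow> nat \<Rightarrow> nat set \<Rightarrow> ((nat \<Rightarrow> 'a) \<Rightarrow> bool) \<Rightarrow> bool" where
  "expressible_from N n V P \<longleftrightarrow>
     (\<forall>\<alpha>\<ge>fin_ord n. expressible N (Sigma_in \<alpha>) V P \<and> expressible N (Pi_in \<alpha>) V P)"

text \<open>One class is available from level \<open>Suc n\<close> on; the second step leaves room
  for an empty block that changes the class.\<close>

lemma expressible_from_Suc_Suc: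
  assumes "(\<forall>\<alpha>>fin_ord n. expressible N (Sigma_in \<alpha>) V P) \<or>
    (\<forall>\<alpha>>fin_ord n. expressible N (Pi_in \<alpha>) V P)"
  shows "expressible_from N (Suc (Suc n)) V P"
  unfolding expressible_from_def
proof (intro allI impI)
  fix \<alpha> assume "fin_ord (Suc (Suc n)) \<le> \<alpha>"
  then have Suc: "fin_ord (Suc n) < \<alpha>" using less_fin_ord_iff[of "Suc n"] by (meson lessI less_le_trans)
  have n: "fin_ord n < fin_ord (Suc n)" by (simp add: less_fin_ord_iff)
  show "expressible N (Sigma_in \<alpha>) V P \<and> expressible N (Pi_in \<alpha>) V P"
    using assms expressible_Sigma[OF _ Suc] expressible_Pi[OF _ Suc] n less_trans[OF n Suc] by blast
qed

lemma expressible_fromD: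
  assumes "expressible_from N n V P" "n \<le> m"
  shows "expressible N (Sigma_in (fin_ord m)) V P" "expressible N (Pi_in (fin_ord m)) V P"
proof -
  have "fin_ord n \<le> fin_ord m" using assms(2) less_fin_ord_iff by (metis leD leI)
  then show "expressible N (Sigma_in (fin_ord m)) V P" "expressible N (Pi_in (fin_ord m)) V P"
    using assms(1) by (simp_all add: expressible_from_def)
qed

lemma expressible_from_qf:
  assumes "qf q" "ifv q \<subseteq> V" "\<And>e. isat N q e \<longleftrightarrow> P e"
  shows "expressible_from N 0 V P"
  using expressible_qf[of q V N P, OF assms] by (simp add: expressible_from_def)

text \<open>The negation is carried through the induction because the normal forms negate only
  quantifier-free formulas: negated conjunctions become disjunctions, negated existential
  quantifiers universal ones.\<close>

lemma finitary_expressible: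
  "\<exists>n. expressible_from N n (fv p) (\<lambda>e. sat N e p) \<and> expressible_from N n (fv p) (\<lambda>e. \<not> sat N e p)"
proof (induction p)
  case (FEq s t)
  have "expressible_from N 0 (fv (FEq s t)) (\<lambda>e. sat N e (FEq s t))"
    by (rule expressible_from_qf[of "IEq s t"]) (auto intro: qf.intros)
  moreover have "expressible_from N 0 (fv (FEq s t)) (\<lambda>e. \<not> sat N e (FEq s t))"
    by (rule expressible_from_qf[of "INeg (IEq s t)"]) (auto intro: qf.intros)
  ultimately show ?case by blast
next
  case (FLt s t)
  have "expressible_from N 0 (fv (FLt s t)) (\<lambda>e. sat N e (FLt s t))"
    by (rule expressible_from_qf[of "ILt s t"]) (auto intro: qf.intros)
  moreover have "expressible_from N 0 (fv (FLt s t)) (\<lambda>e. \<not> sat N e (FLt s t))"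
    by (rule expressible_from_qf[of "INeg (ILt s t)"]) (auto intro: qf.intros)
  ultimately show ?case by blast
next
  case (FNeg p)
  then show ?case by auto
next
  case (FAnd p q)
  then obtain m n where
    m: "expressible_from N m (fv p) (\<lambda>e. sat N e p)" "expressible_from N m (fv p) (\<lambda>e. \<not> sat N e p)" and
    n: "expressible_from N n (fv q) (\<lambda>e. sat N e q)" "expressible_from N n (fv q) (\<lambda>e. \<not> sat N e q)"
    by blast
  let ?k = "max m n"
  have "\<forall>\<alpha>>fin_ord ?k. expressible N (Pi_in \<alpha>) (fv p \<union> fv q) (\<lambda>e. sat N e p \<and> sat N e q)"
    using expressible_Pi_And[OF expressible_fromD(1)[OF m(1), of ?k] expressible_fromD(1)[OF n(1), of ?k]]
    by simp
  then have "expressible_from N (Suc (Suc ?k)) (fv p \<union> fv q) (\<lambda>e. sat N e p \<and> sat N e q)"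
    by (intro expressible_from_Suc_Suc disjI2)
  moreover have "\<forall>\<alpha>>fin_ord ?k. expressible N (Sigma_in \<alpha>) (fv p \<union> fv q) (\<lambda>e. \<not> sat N e p \<or> \<not> sat N e q)"
    using expressible_Sigma_Or[OF expressible_fromD(2)[OF m(2), of ?k] expressible_fromD(2)[OF n(2), of ?k]]
    by simp
  then have "expressible_from N (Suc (Suc ?k)) (fv p \<union> fv q) (\<lambda>e. \<not> sat N e p \<or> \<not> sat N e q)"
    by (intro expressible_from_Suc_Suc disjI1)
  ultimately show ?case unfolding fv.simps sat.simps de_Morgan_conj by blast
next
  case (FEx x p)
  then obtain n where n: "expressible_from N n (fv p) (\<lambda>e. sat N e p)"
    "expressible_from N n (fv p) (\<lambda>e. \<not> sat N e p)"
    by blast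
  have upd: "override_on e f {x} = e(x := f x)" for e f :: "nat \<Rightarrow> 'a"
    by (auto simp: override_on_def)
  have ex: "(\<exists>f. sat N (override_on e f {x}) p) \<longleftrightarrow> sat N e (FEx x p)"
    "(\<forall>f. \<not> sat N (override_on e f {x}) p) \<longleftrightarrow> \<not> sat N e (FEx x p)" for e
    unfolding upd by auto
  have "\<forall>\<alpha>>fin_ord n. expressible N (Sigma_in \<alpha>) (fv (FEx x p)) (\<lambda>e. sat N e (FEx x p))"
    using expressible_Sigma_Ex[OF expressible_fromD(2)[OF n(1) order.refl], of _ "[x]"] by (simp add: ex)
  then have "expressible_from N (Suc (Suc n)) (fv (FEx x p)) (\<lambda>e. sat N e (FEx x p))"
    by (intro expressible_from_Suc_Suc disjI1)
  moreover
  have "\<forall>\<alpha>>fin_ord n. expressible N (Pi_in \<alpha>) (fv (FEx x p)) (\<lambda>e. \<not> sat N e (FEx x p))"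
    using expressible_Pi_All[OF expressible_fromD(1)[OF n(2) order.refl], of _ "[x]"] by (simp add: ex)
  then have "expressible_from N (Suc (Suc n)) (fv (FEx x p)) (\<lambda>e. \<not> sat N e (FEx x p))"
    by (intro expressible_from_Suc_Suc disjI2)
  ultimately show ?case by blast
qed

lemma finitary_expressible_omega:
  "expressible N (Sigma_in \<omega>) (fv p) (\<lambda>e. sat N e p)"
proof -
  obtain n where "expressible_from N n (fv p) (\<lambda>e. sat N e p)"
    using finitary_expressible by blast
  moreover have "fin_ord n < \<omega>" by (auto simp: less_omega_iff)
  ultimately show ?thesis by (simp add: expressible_from_def)
qed

section \<open>Definable predicates\<close>

definition definable :: "'a arith \<Rightarrow> ((nat \<Rightarrow> 'a) \<Rightarrow> bool) \<Rightarrow> bool" where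
  "definable N P \<longleftrightarrow> (\<exists>p. \<forall>e. sat N e p \<longleftrightarrow> P e)"

lemma definable_sat: "definable N (\<lambda>e. sat N e p)"
  by (auto simp: definable_def)

lemma definable_eq: "definable N (\<lambda>e. tmval N e s = tmval N e t)"
  unfolding definable_def by (rule exI[of _ "FEq s t"]) simp

lemma definable_less: "definable N (\<lambda>e. lss N (tmval N e s) (tmval N e t))"
  unfolding definable_def by (rule exI[of _ "FLt s t"]) simp

lemmas definable_var_eq = definable_eq[of _ "TVar x" "TVar y" for x y, simplified]
lemmas definable_var_less = definable_less[of _ "TVar x" "TVar y" for x y, simplified]

lemma definable_not: "definable N P \<Longrightarrow> definable N (\<lambda>e. \<not> P e)"
  unfolding definable_def by (metis sat.simps(3))

lemma definable_and: "definable N P \<Longrightarrow> definable N Q \<Longrightarrow> definable N (\<lambda>e. P e \<and> Q e)"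
  unfolding definable_def by (metis sat.simps(4))

lemma definable_imp: "definable N P \<Longrightarrow> definable N Q \<Longrightarrow> definable N (\<lambda>e. P e \<longrightarrow> Q e)"
  using definable_not[OF definable_and[OF _ definable_not]] by auto

lemma definable_iff: "definable N P \<Longrightarrow> definable N Q \<Longrightarrow> definable N (\<lambda>e. P e \<longleftrightarrow> Q e)"
  using definable_and[OF definable_imp definable_imp, of N P Q Q P] by (simp add: iff_conv_conj_imp)

text \<open>The premise on updates takes the place of a syntactic freshness condition:
  \<open>Q\<close> holds the quantified element in the variable \<open>x\<close>, and the rest of
  \<open>Q\<close> must not react to a change of \<open>x\<close>.\<close>

lemma definable_ex:
  assumes "definable N Q" and "\<And>e a. Q (e(x := a)) \<longleftrightarrow> P e a"
  shows "definable N (\<lambda>e. \<exists>a. P e a)"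
proof -
  obtain p where "\<And>e. sat N e p \<longleftrightarrow> Q e" using assms(1) by (auto simp: definable_def)
  then have "sat N e (FEx x p) \<longleftrightarrow> (\<exists>a. P e a)" for e using assms(2) by simp
  then show ?thesis unfolding definable_def by blast
qed

lemma definable_all:
  assumes "definable N Q" and "\<And>e a. Q (e(x := a)) \<longleftrightarrow> P e a"
  shows "definable N (\<lambda>e. \<forall>a. P e a)"
  using definable_not[OF definable_ex[OF definable_not[OF assms(1)], of x "\<lambda>e a. \<not> P e a"]] assms(2)
  by simp

lemma definable_True: "definable N (\<lambda>_. True)"
  using definable_eq[of N TZero TZero] by simp

lemma definable_ball:
  assumes "finite I" and "\<And>i. i \<in> I \<Longrightarrow> definable N (P i)"
  shows "definable N (\<lambda>e. \<forall>i\<in>I. P i e)"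
  using assms by (induction I) (simp_all add: definable_and definable_True)

text \<open>The variables outside \<open>V\<close> are bound by existential quantifiers; these are
  vacuous, since \<open>P\<close> ignores such variables.\<close>

lemma definable_formula_vars:
  assumes "definable N P" and "\<And>e e'. (\<And>x. x \<in> V \<Longrightarrow> e x = e' x) \<Longrightarrow> P e \<longleftrightarrow> P e'"
  obtains p where "\<And>e. sat N e p \<longleftrightarrow> P e" "fv p \<subseteq> V"
proof -
  have *: "\<exists>q. (\<forall>e. sat N e q \<longleftrightarrow> P e) \<and> fv q = fv p - X"
    if "finite X" "\<And>e. sat N e p \<longleftrightarrow> P e" "X \<inter> V = {}" for X p
    using that
  proof (induction X)
    case (insert x X)
    then obtain q where q: "\<And>e. sat N e q \<longleftrightarrow> P e" "fv q = fv p - X" by auto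
    have "P (e(x := a)) \<longleftrightarrow> P e" for e a
      using insert.prems by (intro assms(2)) auto
    then have "sat N e (FEx x q) \<longleftrightarrow> P e" for e using q by simp
    moreover have "fv (FEx x q) = fv p - insert x X" using q by auto
    ultimately show ?case by blast
  qed auto
  obtain p where p: "\<And>e. sat N e p \<longleftrightarrow> P e" using assms(1) by (auto simp: definable_def)
  then show thesis
    using *[of "fv p - V" p] that finite_fv by blast
qed

section \<open>Models of Peano arithmetic\<close>

locale peano =
  fixes N :: "'a arith"
  assumes PA: "models_PA N"
begin

abbreviation zero_N :: 'a ("\<zero>") where "\<zero> \<equiv> zro N"
abbreviation one_N :: 'a ("\<one>") where "\<one> \<equiv> uno N"
abbreviation add_N :: "'a \<Rightarrow> 'a \<Rightarrow> 'a" (infixl "\<oplus>" 65) where "x \<oplus> y \<equiv> add N x y"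
abbreviation mul_N :: "'a \<Rightarrow> 'a \<Rightarrow> 'a" (infixl "\<otimes>" 70) where "x \<otimes> y \<equiv> mul N x y"
abbreviation less_N :: "'a \<Rightarrow> 'a \<Rightarrow> bool" (infix "\<prec>" 50) where "x \<prec> y \<equiv> lss N x y"

lemma add_assoc: "x \<oplus> y \<oplus> z = x \<oplus> (y \<oplus> z)"
  and add_commute: "x \<oplus> y = y \<oplus> x"
  and mul_assoc: "x \<otimes> y \<otimes> z = x \<otimes> (y \<otimes> z)"
  and mul_commute: "x \<otimes> y = y \<otimes> x"
  and distrib_left: "x \<otimes> (y \<oplus> z) = x \<otimes> y \<oplus> x \<otimes> z"
  and add_0_right: "x \<oplus> \<zero> = x"
  and mul_0_right: "x \<otimes> \<zero> = \<zero>"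
  and mul_1_right: "x \<otimes> \<one> = x"
  and less_trans: "x \<prec> y \<Longrightarrow> y \<prec> z \<Longrightarrow> x \<prec> z"
  and less_irrefl: "\<not> x \<prec> x"
  and less_linear: "x \<prec> y \<or> x = y \<or> y \<prec> x"
  and add_less_mono: "x \<prec> y \<Longrightarrow> x \<oplus> z \<prec> y \<oplus> z"
  and mul_less_mono: "\<zero> \<prec> z \<Longrightarrow> x \<prec> y \<Longrightarrow> x \<otimes> z \<prec> y \<otimes> z"
  and less_imp_add: "x \<prec> y \<Longrightarrow> \<exists>z. x \<oplus> z = y"
  and zero_less_one: "\<zero> \<prec> \<one>"
  and one_le: "\<zero> \<prec> x \<Longrightarrow> \<one> = x \<or> \<one> \<prec> x"
  and zero_le: "\<zero> = x \<or> \<zero> \<prec> x"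
  by (insert PA[unfolded models_PA_def PA_minus_def, THEN conjunct1], elim conjE, metis)+

lemma add_left_commute: "x \<oplus> (y \<oplus> z) = y \<oplus> (x \<oplus> z)"
  by (metis add_assoc add_commute)

lemma mul_left_commute: "x \<otimes> (y \<otimes> z) = y \<otimes> (x \<otimes> z)"
  by (metis mul_assoc mul_commute)

lemma distrib_right: "(x \<oplus> y) \<otimes> z = x \<otimes> z \<oplus> y \<otimes> z"
  by (metis distrib_left mul_commute)

lemma add_0_left: "\<zero> \<oplus> x = x" and mul_0_left: "\<zero> \<otimes> x = \<zero>" and mul_1_left: "\<one> \<otimes> x = x"
  by (metis add_commute add_0_right, metis mul_commute mul_0_right, metis mul_commute mul_1_right)

lemmas semiring_simps = add_assoc add_commute add_left_commute mul_assoc mul_commute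
  mul_left_commute distrib_left distrib_right add_0_left add_0_right mul_0_left mul_0_right
  mul_1_left mul_1_right

lemma less_asym: "x \<prec> y \<Longrightarrow> \<not> y \<prec> x"
  using less_trans less_irrefl by blast

lemma not_less_zero: "\<not> x \<prec> \<zero>"
  using zero_le less_asym less_irrefl by metis

lemma add_right_cancel: "x \<oplus> z = y \<oplus> z \<longleftrightarrow> x = y"
  using less_linear[of x y] add_less_mono less_irrefl by metis

lemma less_add: "z \<noteq> \<zero> \<Longrightarrow> x \<prec> x \<oplus> z"
  using zero_le[of z] add_less_mono[of \<zero> z x] by (metis add_0_left add_commute)

lemma less_le_add: "x \<prec> y \<Longrightarrow> x \<prec> y \<oplus> z"
  using less_add[of z y] less_trans[of x y] by (cases "z = \<zero>") (auto simp: add_0_right)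

lemma not_add_less: "\<not> x \<oplus> z \<prec> x"
  using less_le_add less_irrefl by blast

lemma nonzero_Suc: "z \<noteq> \<zero> \<Longrightarrow> \<exists>w. z = \<one> \<oplus> w"
  using zero_le[of z] one_le[of z] less_imp_add[of \<one> z] add_0_right[of \<one>] by metis

text \<open>Discreteness: if \<open>y\<close> is below \<open>x\<close>, the difference is nonzero
  and so has \<one> as a summand, which puts \<open>x\<close> at or above
  \<open>y \<oplus> \<one>\<close>.\<close>

lemma less_add_one_iff: "x \<prec> y \<oplus> \<one> \<longleftrightarrow> x \<prec> y \<or> x = y"
proof
  assume *: "x \<prec> y \<oplus> \<one>"
  show "x \<prec> y \<or> x = y"
  proof (rule ccontr)
    assume "\<not> ?thesis"
    then have "y \<prec> x" using less_linear by blast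
    then obtain z where z: "x = y \<oplus> z" "z \<noteq> \<zero>" using less_imp_add add_0_right less_irrefl by metis
    then obtain w where "x = y \<oplus> \<one> \<oplus> w" using nonzero_Suc add_assoc by metis
    then show False using * not_add_less by blast
  qed
qed (use less_add[of \<one> y] less_le_add zero_less_one less_irrefl in metis)

section \<open>Standard numerals, overspill and the least number principle\<close>

primrec num :: "nat \<Rightarrow> 'a" where
  "num 0 = \<zero>"
| "num (Suc n) = num n \<oplus> \<one>"

lemma num_add: "num (m + n) = num m \<oplus> num n"
  by (induction n) (simp_all add: add_0_right add_assoc)

lemma num_mult: "num (m * n) = num m \<otimes> num n"
  by (induction n) (simp_all add: mul_0_right num_add distrib_left mul_1_right add_commute)

text \<open>Follows from discreteness. The standard elements are thus an initial segment, and only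
  finitely many elements lie below a standard one.\<close>

lemma less_num_iff: "x \<prec> num m \<longleftrightarrow> (\<exists>i<m. x = num i)"
  by (induction m) (auto simp: not_less_zero less_add_one_iff less_Suc_eq)

lemma num_less: "i < j \<Longrightarrow> num i \<prec> num j"
  by (auto simp: less_num_iff)

lemma num_eq_iff: "num i = num j \<longleftrightarrow> i = j"
  using num_less less_irrefl by (metis linorder_neqE_nat)

lemma num_less_iff: "num i \<prec> num j \<longleftrightarrow> i < j"
  by (auto simp: less_num_iff num_eq_iff)

lemma infinite_model: "infinite (UNIV :: 'a set)"
proof -
  have "inj num" by (auto intro: injI simp: num_eq_iff)
  then show ?thesis by (meson finite_imageD finite_subset infinite_UNIV_nat subset_UNIV)
qed

lemma num_less_nonstandard: "k \<notin> range num \<Longrightarrow> num i \<prec> k"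
  using less_linear[of "num i" k] less_num_iff by (metis rangeI)

lemma nonstandard_element:
  assumes "nonstandard N"
  obtains k where "k \<notin> range num"
proof -
  have "\<not> surj num"
  proof
    assume "surj num"
    then have "bij num" by (auto intro!: bijI injI simp: num_eq_iff)
    then have "isomorphism num standard_arith N"
      by (simp add: isomorphism_def standard_arith_def num_add num_mult num_less_iff add_0_left)
    then show False using assms by (auto simp: nonstandard_def)
  qed
  then show thesis using that by blast
qed

text \<open>Otherwise \<open>P\<close> would define the standard cut, which contains \<zero> and is
  closed under successor, so induction would make every element standard.\<close>

lemma overspill:
  assumes "nonstandard N" and "definable N P" and "\<And>m. P (e(x := num m))"
  obtains k where "k \<notin> range num" "P (e(x := k))"
proof (rule ccontr)
  assume "\<not> thesis"
  then have iff: "P (e(x := a)) \<longleftrightarrow> a \<in> range num" for a using that assms(3) by blast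
  obtain p where p: "\<And>e. sat N e p \<longleftrightarrow> P e" using assms(2) by (auto simp: definable_def)
  have step: "a \<oplus> \<one> \<in> range num" if "a \<in> range num" for a
  proof -
    obtain m where "a = num m" using \<open>a \<in> range num\<close> by blast
    then have "a \<oplus> \<one> = num (Suc m)" by simp
    then show ?thesis by (rule range_eqI)
  qed
  have "\<zero> \<in> range num" using num.simps(1)[symmetric] by (rule range_eqI)
  then have all: "P (e(x := a))" for a
    using PA[unfolded models_PA_def, THEN conjunct2, unfolded induction_scheme_def, rule_format, of e x p a]
      step by (simp add: p iff)
  obtain k where "k \<notin> range num" using nonstandard_element[OF assms(1)] .
  then show False using iff all by simp
qed

text \<open>Without a least witness, the absence of witnesses below \<open>b\<close> is inductive in
  \<open>b\<close>, which is kept in the fresh variable \<open>y\<close>. It then holds for all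
  \<open>b\<close>, in particular for the successor of \<open>c\<close>.\<close>

lemma least_element:
  assumes "definable N P" and "P (e(x := c))"
  shows "\<exists>a. P (e(x := a)) \<and> (\<forall>z. z \<prec> a \<longrightarrow> \<not> P (e(x := z)))"
proof (rule ccontr)
  assume no: "\<not> ?thesis"
  obtain p where p: "\<And>e. sat N e p \<longleftrightarrow> P e" using assms(1) by (auto simp: definable_def)
  obtain y where y: "y \<notin> insert x (fv p)"
    using finite_fv[of p] ex_new_if_finite infinite_UNIV_nat by (metis finite_insert)
  have indep: "P ((e(y := b))(x := z)) \<longleftrightarrow> P (e(x := z))" for b z
    unfolding p[symmetric] by (rule sat_cong) (use y in auto)
  let ?Q = "\<lambda>e'. \<forall>z. z \<prec> e' y \<longrightarrow> \<not> P (e'(x := z))"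
  have "definable N ?Q"
  proof (rule definable_all)
    show "definable N (\<lambda>e'. e' x \<prec> e' y \<longrightarrow> \<not> P e')"
      by (intro definable_imp definable_not definable_var_less assms(1))
  qed (use y in auto)
  then obtain q where q: "\<And>e. sat N e q \<longleftrightarrow> ?Q e" by (auto simp: definable_def)
  have Q: "?Q (e(y := b)) \<longleftrightarrow> (\<forall>z. z \<prec> b \<longrightarrow> \<not> P (e(x := z)))" for b by (simp add: indep)
  have "\<forall>b. \<forall>z. z \<prec> b \<longrightarrow> \<not> P (e(x := z))"
    using PA[unfolded models_PA_def, THEN conjunct2, unfolded induction_scheme_def, rule_format, of e y q]
      no unfolding q Q less_add_one_iff by (metis not_less_zero)
  then show False using assms(2) less_add_one_iff by blast
qed

subsection \<open>Coding finite sequences of standard length\<close>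

definition modulus :: "'a \<Rightarrow> 'a \<Rightarrow> 'a" where
  "modulus y i = \<one> \<oplus> (i \<oplus> \<one>) \<otimes> y"

text \<open>The graph of Goedel's beta function: \<open>c\<close> is the remainder of
  \<open>x\<close> modulo \<open>1 + (i + 1) y\<close>.\<close>

definition entry :: "'a \<Rightarrow> 'a \<Rightarrow> 'a \<Rightarrow> 'a \<Rightarrow> bool" where
  "entry x y i c \<longleftrightarrow> c \<prec> modulus y i \<and> (\<exists>t. x = c \<oplus> t \<otimes> modulus y i)"

text \<open>Uniqueness of division with remainder: if the quotients differed, one remainder would
  contain a full copy of the modulus.\<close>

lemma entry_unique:
  assumes "entry x y i c" "entry x y i c'"
  shows "c = c'"
proof -
  have less: "\<not> t \<prec> t'" if "c \<prec> P" "c \<oplus> t \<otimes> P = c' \<oplus> t' \<otimes> P" for c c' t t' P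
  proof
    assume "t \<prec> t'"
    then obtain z where z: "t' = t \<oplus> z" "z \<noteq> \<zero>"
      using less_imp_add add_0_right less_irrefl by metis
    then obtain w where w: "t' = t \<oplus> (\<one> \<oplus> w)" using nonzero_Suc by metis
    have "c \<oplus> t \<otimes> P = P \<oplus> (c' \<oplus> w \<otimes> P) \<oplus> t \<otimes> P"
      using that(2) by (simp add: w semiring_simps)
    then have "c = P \<oplus> (c' \<oplus> w \<otimes> P)" by (simp only: add_right_cancel)
    then show False using that(1) not_add_less by blast
  qed
  obtain t t' where t: "x = c \<oplus> t \<otimes> modulus y i" "x = c' \<oplus> t' \<otimes> modulus y i"
    "c \<prec> modulus y i" "c' \<prec> modulus y i"
    using assms unfolding entry_def by blast
  then have "t = t'"
    using less[of c "modulus y i" t c' t'] less[of c' "modulus y i" t' c t] less_linear[of t t'] by metis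
  then show ?thesis using t add_right_cancel by metis
qed

text \<open>At index \<zero> the modulus is \<open>x \<oplus> \<one>\<close>, which exceeds
  \<open>x\<close>. Hence one coordinate of a position, paired with itself, already codes its own
  value.\<close>

lemma entry_self: "entry x x \<zero> x"
proof -
  have "x \<prec> modulus x \<zero>"
    using less_add_one_iff[of x x] by (simp add: modulus_def add_0_left mul_1_left add_commute[of \<one>])
  moreover have "x = x \<oplus> \<zero> \<otimes> modulus x \<zero>" by (simp add: mul_0_left add_0_right)
  ultimately show ?thesis unfolding entry_def by blast
qed

section \<open>The Chinese remainder theorem without subtraction\<close>

definition unit_mod :: "'a \<Rightarrow> 'a \<Rightarrow> bool" where
  "unit_mod P q \<longleftrightarrow> (\<exists>u k. q \<otimes> u = \<one> \<oplus> k \<otimes> P)"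

lemma unit_mod_mul:
  assumes "unit_mod P q" "unit_mod P q'"
  shows "unit_mod P (q \<otimes> q')"
proof -
  obtain u k u' k' where *: "q \<otimes> u = \<one> \<oplus> k \<otimes> P" "q' \<otimes> u' = \<one> \<oplus> k' \<otimes> P"
    using assms by (auto simp: unit_mod_def)
  have "(q \<otimes> q') \<otimes> (u \<otimes> u') = (q \<otimes> u) \<otimes> (q' \<otimes> u')" by (simp only: semiring_simps)
  also have "\<dots> = \<one> \<oplus> (k \<oplus> k' \<oplus> k \<otimes> k' \<otimes> P) \<otimes> P" unfolding * by (simp only: semiring_simps)
  finally show ?thesis unfolding unit_mod_def by blast
qed

text \<open>
  Writing \<open>P\<^sub>i = 1 + (i + 1) d\<close> with \<open>d = (j - i) q\<close>, one has \<open>q (j + 1) P\<^sub>i \<equiv> d\<close> and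
  \<open>((j + 1) d)\<^sup>2 \<equiv> 1\<close> modulo \<open>P\<^sub>j\<close>.
\<close>

lemma unit_mod_modulus:
  assumes "i < j" and d: "d = num (j - i) \<otimes> q" "d \<noteq> \<zero>"
  shows "unit_mod (modulus d (num j)) (modulus d (num i))"
proof -
  define J where "J = num j \<oplus> \<one>"
  define I where "I = num i \<oplus> \<one>"
  define P where "P = modulus d (num j)"
  have P: "P = \<one> \<oplus> J \<otimes> d" by (simp add: P_def modulus_def J_def)
  have J: "J = num (j - i) \<oplus> I"
    using assms(1) num_add[of "j - i" i] by (simp add: J_def I_def add_assoc)
  have "J \<otimes> d \<noteq> \<zero>"
  proof -
    have "\<zero> \<prec> d" "\<zero> \<prec> J"
      using zero_le[of d] d(2) num_less[of 0 "Suc j"] by (auto simp: J_def)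
    then have "\<zero> \<otimes> d \<prec> J \<otimes> d" by (rule mul_less_mono)
    then show ?thesis using less_irrefl by (auto simp: mul_0_left)
  qed
  then obtain z where z: "J \<otimes> d = \<one> \<oplus> z" using nonzero_Suc by blast
  have "q \<otimes> J \<otimes> modulus d (num i) = q \<otimes> (J \<oplus> J \<otimes> I \<otimes> d)"
    unfolding modulus_def I_def[symmetric] by (simp only: semiring_simps)
  also have "J \<oplus> J \<otimes> I \<otimes> d = num (j - i) \<oplus> I \<otimes> P"
    unfolding P by (subst (1) J) (simp only: semiring_simps)
  also have "q \<otimes> (num (j - i) \<oplus> I \<otimes> P) = d \<oplus> q \<otimes> I \<otimes> P"
    by (simp only: d(1) semiring_simps)
  finally have 1: "q \<otimes> J \<otimes> modulus d (num i) = d \<oplus> q \<otimes> I \<otimes> P" .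
  \<comment> \<open>With \<open>J d = 1 + z\<close> the modulus \<open>P\<close> is
    \<open>2 + z\<close>, and \<open>(1 + z)(1 + z) = 1 + z (2 + z)\<close>. This is the square of
    -1 modulo \<open>P\<close>.\<close>
  have "(J \<otimes> d) \<otimes> (J \<otimes> d) = \<one> \<oplus> z \<otimes> P"
    unfolding P z by (simp only: semiring_simps)
  then have 2: "J \<otimes> (J \<otimes> d) \<otimes> d = \<one> \<oplus> z \<otimes> P" by (simp only: semiring_simps)
  have "modulus d (num i) \<otimes> (J \<otimes> (J \<otimes> d) \<otimes> (q \<otimes> J)) =
      J \<otimes> (J \<otimes> d) \<otimes> (q \<otimes> J \<otimes> modulus d (num i))"
    by (simp only: semiring_simps)
  also have "\<dots> = J \<otimes> (J \<otimes> d) \<otimes> d \<oplus> J \<otimes> (J \<otimes> d) \<otimes> (q \<otimes> I \<otimes> P)"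
    unfolding 1 distrib_left ..
  also have "\<dots> = \<one> \<oplus> (z \<oplus> J \<otimes> (J \<otimes> d) \<otimes> (q \<otimes> I)) \<otimes> P"
    unfolding 2 by (simp only: semiring_simps)
  finally show ?thesis unfolding unit_mod_def P_def[symmetric] by blast
qed

text \<open>Congruences are added one at a time: a multiple of all earlier moduli that is invertible
  modulo the new one corrects the new residue and keeps the old ones. The divisibility assumption on
  \<open>d\<close> makes the moduli coprime. The induction is on a standard number, so products need
  no coding inside the model.\<close>

lemma chinese_remainder:
  assumes d: "d \<noteq> \<zero>" "\<forall>n. 0 < n \<and> n \<le> m \<longrightarrow> (\<exists>q. d = num n \<otimes> q)"
  shows "j \<le> m \<Longrightarrow> \<exists>x. \<forall>i<j. \<exists>t. x = c i \<oplus> t \<otimes> modulus d (num i)"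
proof (induction j)
  case (Suc j)
  then obtain x where x: "\<And>i. i < j \<Longrightarrow> \<exists>t. x = c i \<oplus> t \<otimes> modulus d (num i)" by auto
  define P where "P = modulus d (num j)"
  \<comment> \<open>\<open>Q\<close> is the product of the moduli with index below \<open>l\<close>.
    Each factor is invertible modulo \<open>P\<close> because \<open>d\<close> is a multiple of
    \<open>j - l\<close>.\<close>
  have "\<exists>Q. unit_mod P Q \<and> (\<forall>i<l. \<exists>r. Q = r \<otimes> modulus d (num i))" if "l \<le> j" for l
    using that
  proof (induction l)
    case 0
    have "\<one> \<otimes> \<one> = \<one> \<oplus> \<zero> \<otimes> P" by (simp only: semiring_simps)
    then show ?case unfolding unit_mod_def by blast
  next
    case (Suc l)
    then obtain Q where Q: "unit_mod P Q" "\<And>i. i < l \<Longrightarrow> \<exists>r. Q = r \<otimes> modulus d (num i)" by auto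
    have "0 < j - l" "j - l \<le> m" using Suc.prems \<open>Suc j \<le> m\<close> by auto
    then obtain q where "d = num (j - l) \<otimes> q" using d(2) by blast
    then have "unit_mod P (Q \<otimes> modulus d (num l))"
      unfolding P_def using Suc.prems d(1) Q(1)
      by (intro unit_mod_mul unit_mod_modulus) (auto simp: P_def)
    moreover have "\<exists>r. Q \<otimes> modulus d (num l) = r \<otimes> modulus d (num i)" if i: "i < Suc l" for i
    proof (cases "i = l")
      case False
      then obtain r where "Q = r \<otimes> modulus d (num i)" using Q(2)[of i] i by auto
      then have "Q \<otimes> modulus d (num l) = r \<otimes> modulus d (num l) \<otimes> modulus d (num i)"
        by (simp only: mul_assoc mul_commute mul_left_commute)
      then show ?thesis by blast
    qed blast
    ultimately show ?case by blast
  qed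
  from this[OF order.refl]
  obtain Q where Q: "unit_mod P Q" "\<And>i. i < j \<Longrightarrow> \<exists>r. Q = r \<otimes> modulus d (num i)" by blast
  then obtain u k where u: "Q \<otimes> u = \<one> \<oplus> k \<otimes> P" by (auto simp: unit_mod_def)
  define J where "J = num j \<oplus> \<one>"
  have P: "P = \<one> \<oplus> J \<otimes> d" by (simp add: P_def modulus_def J_def)
  \<comment> \<open>Since \<open>J d\<close> is -1 modulo \<open>P\<close>, the element
    \<open>s\<close> stands for the difference of \<open>c j\<close> and \<open>x\<close>:
    \<open>x \<oplus> s\<close> is congruent to \<open>c j\<close>.\<close>
  define s where "s = c j \<oplus> J \<otimes> d \<otimes> x"
  define x' where "x' = x \<oplus> Q \<otimes> u \<otimes> s"
  have "x' = x \<oplus> s \<oplus> k \<otimes> P \<otimes> s"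
    unfolding x'_def u by (simp only: distrib_right mul_1_left add_assoc)
  also have "x \<oplus> s = c j \<oplus> P \<otimes> x"
    unfolding s_def P by (simp only: semiring_simps)
  finally have "x' = c j \<oplus> (x \<oplus> k \<otimes> s) \<otimes> P" by (simp only: semiring_simps)
  then have "\<exists>t. x' = c j \<oplus> t \<otimes> modulus d (num j)" unfolding P_def by blast
  moreover have "\<exists>t. x' = c i \<oplus> t \<otimes> modulus d (num i)" if i: "i < j" for i
  proof -
    obtain t r where t: "x = c i \<oplus> t \<otimes> modulus d (num i)" and r: "Q = r \<otimes> modulus d (num i)"
      using x[OF i] Q(2)[OF i] by blast
    have "x' = c i \<oplus> t \<otimes> modulus d (num i) \<oplus> r \<otimes> modulus d (num i) \<otimes> u \<otimes> s"
      unfolding x'_def t[symmetric] r[symmetric] ..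
    then have "x' = c i \<oplus> (t \<oplus> r \<otimes> u \<otimes> s) \<otimes> modulus d (num i)" by (simp only: semiring_simps)
    then show ?thesis by blast
  qed
  ultimately show ?case by (metis less_Suc_eq)
qed auto

lemma finite_bounded:
  assumes "finite C"
  shows "\<exists>b. \<forall>c\<in>C. c \<prec> b"
  using assms
proof (induction C)
  case (insert c C)
  then obtain b where b: "\<forall>c\<in>C. c \<prec> b" by blast
  have "c' \<prec> b \<oplus> (c \<oplus> \<one>)" if "c' \<in> insert c C" for c'
  proof (cases "c' = c")
    case True
    have "c \<prec> c \<oplus> \<one> \<oplus> b" using less_add_one_iff less_le_add by blast
    then show ?thesis using True by (simp add: add_commute)
  next
    case False
    then show ?thesis using that b less_le_add by blast
  qed
  then show ?case by blast
qed auto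

lemma sequence_code:
  obtains d x where "\<And>i. i < length cs \<Longrightarrow> entry x d (num i) (cs ! i)"
proof -
  let ?m = "length cs"
  obtain b where b: "\<And>c. c \<in> set cs \<Longrightarrow> c \<prec> b" using finite_bounded[OF finite_set] by blast
  \<comment> \<open>The summand \<one> keeps \<open>d\<close> nonzero even for an empty list. The
    factor \<open>b'\<close> puts \<open>d\<close> above all entries, and the factorial makes it
    divisible by every positive number up to the length.\<close>
  define b' where "b' = b \<oplus> \<one>"
  define d where "d = b' \<otimes> num (fact ?m)"
  have "\<exists>z. num (fact ?m) = \<one> \<oplus> z"
  proof -
    have "num (fact ?m) = \<one> \<oplus> num (fact ?m - 1)"
      using num_add[of 1 "fact ?m - 1"] fact_ge_1[of ?m] by (simp add: add_0_left)
    then show ?thesis by blast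
  qed
  then obtain z where z: "d = b' \<oplus> b' \<otimes> z" unfolding d_def by (auto simp: distrib_left mul_1_right)
  have bd: "c \<prec> d" if "c \<in> set cs \<or> c = b" for c
    using that b less_le_add less_add_one_iff unfolding z b'_def by metis
  have d0: "d \<noteq> \<zero>" using bd not_less_zero by blast
  have dvd: "\<forall>n. 0 < n \<and> n \<le> ?m \<longrightarrow> (\<exists>q. d = num n \<otimes> q)"
  proof (intro allI impI)
    fix n assume n: "0 < n \<and> n \<le> ?m"
    then have "n dvd fact ?m" by (simp add: dvd_fact)
    then obtain q where "fact ?m = n * q" by (auto simp: dvd_def)
    then have "d = num n \<otimes> (b' \<otimes> num q)"
      unfolding d_def by (simp only: num_mult mul_left_commute)
    then show "\<exists>q. d = num n \<otimes> q" by blast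
  qed
  obtain x where x: "\<And>i. i < ?m \<Longrightarrow> \<exists>t. x = cs ! i \<oplus> t \<otimes> modulus d (num i)"
    using chinese_remainder[where c = "\<lambda>i. cs ! i" and m = ?m and j = ?m, OF d0 dvd] by blast
  have "entry x d (num i) (cs ! i)" if "i < ?m" for i
  proof -
    have "cs ! i \<prec> d \<oplus> (num i \<otimes> d \<oplus> \<one>)" using bd less_le_add that by simp
    also have "d \<oplus> (num i \<otimes> d \<oplus> \<one>) = modulus d (num i)"
      unfolding modulus_def by (simp only: semiring_simps)
    finally show ?thesis using x[OF that] by (simp add: entry_def)
  qed
  then show thesis using that by blast
qed

end

text \<open>Recoding by natural numbers keeps the type of the classifying function fixed in an
  induction whose step passes to sets of classes.\<close>

lemma finite_range_nat_code:
  assumes "finite (range f)"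
  shows "\<exists>g :: 'a \<Rightarrow> nat. finite (range g) \<and> (\<forall>x y. g x = g y \<longrightarrow> f x = f y)"
proof -
  obtain h :: "'b \<Rightarrow> nat" where h: "inj_on h (range f)"
    using finite_imp_inj_to_nat_seg[OF assms] by blast
  have "finite (range (\<lambda>x. h (f x)))"
    using finite_imageI[OF assms, of h] by (simp add: image_image)
  moreover have "f x = f y" if "h (f x) = h (f y)" for x y using inj_onD[OF h that] by simp
  ultimately show ?thesis by blast
qed

context peano
begin

subsection \<open>Approximations to the back-and-forth relations\<close>

text \<open>The six clauses of \<open>partial_iso\<close>, given the same three arguments so that
  one number \<open>c\<close> ranges over them.\<close>

definition atom :: "nat \<Rightarrow> 'a \<Rightarrow> 'a \<Rightarrow> 'a \<Rightarrow> bool" where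
  "atom c u v w \<longleftrightarrow> [u = \<zero>, u = \<one>, u = v, u \<prec> v, w = u \<oplus> v, w = u \<otimes> v] ! c"

text \<open>The list \<open>xs\<close> holds three codes of two components each, read at the indices
  \<open>i\<close>, \<open>j\<close> and \<open>l\<close>.\<close>

definition entry_atom :: "nat \<Rightarrow> 'a list \<Rightarrow> 'a \<Rightarrow> 'a \<Rightarrow> 'a \<Rightarrow> bool" where
  "entry_atom c xs i j l \<longleftrightarrow> (\<exists>u v w. entry (xs ! 0) (xs ! 1) i u \<and> entry (xs ! 2) (xs ! 3) j v \<and>
     entry (xs ! 4) (xs ! 5) l w \<and> atom c u v w)"

definition six_tuples :: "nat \<Rightarrow> nat list set" where
  "six_tuples r = {\<sigma>. set \<sigma> \<subseteq> {..<r} \<and> length \<sigma> = 6}"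

text \<open>Here \<open>n\<close> is the number of rounds left and \<open>r\<close> the number of
  coordinates played. Any two coordinates may be combined into a code. The bound \<open>k\<close> is
  an element of the model, possibly nonstandard.\<close>

primrec game :: "nat \<Rightarrow> nat \<Rightarrow> 'a \<Rightarrow> (nat \<Rightarrow> 'a) \<Rightarrow> (nat \<Rightarrow> 'a) \<Rightarrow> bool" where
  "game 0 r k A B \<longleftrightarrow> (\<forall>c\<in>{..<6}. \<forall>\<sigma>\<in>six_tuples r. \<forall>i j l. i \<prec> k \<and> j \<prec> k \<and> l \<prec> k \<longrightarrow>
     (entry_atom c (map A \<sigma>) i j l \<longleftrightarrow> entry_atom c (map B \<sigma>) i j l))"
| "game (Suc n) r k A B \<longleftrightarrow>
     (\<forall>a. \<exists>b. game n (Suc r) k (A(r := a)) (B(r := b))) \<and>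
     (\<forall>b. \<exists>a. game n (Suc r) k (A(r := a)) (B(r := b)))"

lemma finite_six_tuples: "finite (six_tuples r)"
  unfolding six_tuples_def by (rule finite_lists_length_eq) simp

lemma game_sym: "game n r k A B \<longleftrightarrow> game n r k B A"
  by (induction n arbitrary: r A B) auto

lemma game_0_less: "game 0 r k A B" if "game 0 r' k A' B'" "r \<le> r'"
  "\<And>s. s < r \<Longrightarrow> A' s = A s" "\<And>s. s < r \<Longrightarrow> B' s = B s"
proof -
  have \<sigma>: "map A' \<sigma> = map A \<sigma> \<and> map B' \<sigma> = map B \<sigma> \<and> \<sigma> \<in> six_tuples r'" if "\<sigma> \<in> six_tuples r" for \<sigma>
  proof -
    have "\<And>s. s \<in> set \<sigma> \<Longrightarrow> s < r" "length \<sigma> = 6" using that by (auto simp: six_tuples_def)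
    then show ?thesis
      using \<open>r \<le> r'\<close> \<open>\<And>s. s < r \<Longrightarrow> A' s = A s\<close> \<open>\<And>s. s < r \<Longrightarrow> B' s = B s\<close>
      by (force simp: six_tuples_def)
  qed
  show ?thesis
    unfolding game.simps
  proof (intro ballI allI impI)
    fix c :: nat and \<sigma> i j l
    assume "c \<in> {..<6}" "\<sigma> \<in> six_tuples r" "i \<prec> k \<and> j \<prec> k \<and> l \<prec> k"
    then show "entry_atom c (map A \<sigma>) i j l \<longleftrightarrow> entry_atom c (map B \<sigma>) i j l"
      using that(1)[unfolded game.simps, rule_format, of c \<sigma> i j l] \<sigma>[of \<sigma>] by simp
  qed
qed

text \<open>Arbitrary moves are played and then forgotten.\<close>

lemma game_imp_game_0: "game n r k A B \<Longrightarrow> game 0 r k A B"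
proof (induction n arbitrary: r A B)
  case (Suc n)
  then obtain a b where "game n (Suc r) k (A(r := a)) (B(r := b))"
    by (metis game.simps(2))
  then have "game 0 (Suc r) k (A(r := a)) (B(r := b))" by (rule Suc.IH)
  then show ?case by (rule game_0_less) auto
qed simp

section \<open>Definability of the game\<close>

lemma definable_entry: "definable N (\<lambda>e. entry (e x) (e y) (e i) (e c))"
proof -
  let ?t = "Suc (x + y + i + c)"
  let ?m = "TAdd TOne (TMul (TAdd (TVar i) TOne) (TVar y))"
  have "definable N (\<lambda>e. \<exists>t. e x = e c \<oplus> t \<otimes> modulus (e y) (e i))"
    by (rule definable_ex[OF definable_eq[of N "TVar x" "TAdd (TVar c) (TMul (TVar ?t) ?m)"],
          where x = ?t]) (simp add: modulus_def)
  moreover have "definable N (\<lambda>e. e c \<prec> modulus (e y) (e i))"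
    using definable_less[of N "TVar c" ?m] by (simp add: modulus_def)
  ultimately show ?thesis unfolding entry_def by (intro definable_and)
qed

lemma definable_atom:
  assumes "c < 6"
  shows "definable N (\<lambda>e. atom c (e u) (e v) (e w))"
proof -
  have "c \<in> {0, 1, 2, 3, 4, 5}" using assms by auto
  then show ?thesis
    using definable_eq[of N "TVar u" TZero] definable_eq[of N "TVar u" TOne]
      definable_var_eq[of N u v] definable_var_less[of N u v]
      definable_eq[of N "TVar w" "TAdd (TVar u) (TVar v)"]
      definable_eq[of N "TVar w" "TMul (TVar u) (TVar v)"]
    by (auto simp: atom_def)
qed

lemma definable_entry_atom:
  assumes "c < 6" "length vs = 6"
  shows "definable N (\<lambda>e. entry_atom c (map e vs) (e i) (e j) (e l))"
proof -
  \<comment> \<open>A number above all variables in use; \<open>M\<close>, \<open>Suc M\<close> and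
    \<open>Suc (Suc M)\<close> carry the three entries.\<close>
  define M where "M = Suc (sum_list vs + i + j + l)"
  have less: "vs ! q < M" if "q < 6" for q
    using that assms(2) member_le_sum_list[of "vs ! q" vs] by (simp add: M_def)
  have neq: "vs ! q \<noteq> M" "vs ! q \<noteq> Suc M" "vs ! q \<noteq> Suc (Suc M)" if "q < 6" for q
    using less[OF that] by auto
  have ijl: "i < M" "j < M" "l < M" by (auto simp: M_def)
  have "definable N (\<lambda>e. entry (e (vs ! 0)) (e (vs ! 1)) (e i) (e M) \<and>
    entry (e (vs ! 2)) (e (vs ! 3)) (e j) (e (Suc M)) \<and>
    entry (e (vs ! 4)) (e (vs ! 5)) (e l) (e (Suc (Suc M))) \<and> atom c (e M) (e (Suc M)) (e (Suc (Suc M))))"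
    by (intro definable_and definable_entry definable_atom assms)
  then have "definable N (\<lambda>e. \<exists>w. entry (e (vs ! 0)) (e (vs ! 1)) (e i) (e M) \<and>
    entry (e (vs ! 2)) (e (vs ! 3)) (e j) (e (Suc M)) \<and>
    entry (e (vs ! 4)) (e (vs ! 5)) (e l) w \<and> atom c (e M) (e (Suc M)) w)"
    by (rule definable_ex[where x = "Suc (Suc M)"]) (use neq ijl in simp)
  then have "definable N (\<lambda>e. \<exists>v w. entry (e (vs ! 0)) (e (vs ! 1)) (e i) (e M) \<and>
    entry (e (vs ! 2)) (e (vs ! 3)) (e j) v \<and>
    entry (e (vs ! 4)) (e (vs ! 5)) (e l) w \<and> atom c (e M) v w)"
    by (rule definable_ex[where x = "Suc M"]) (use neq ijl in simp)
  then have "definable N (\<lambda>e. \<exists>u v w. entry (e (vs ! 0)) (e (vs ! 1)) (e i) u \<and>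
    entry (e (vs ! 2)) (e (vs ! 3)) (e j) v \<and>
    entry (e (vs ! 4)) (e (vs ! 5)) (e l) w \<and> atom c u v w)"
    by (rule definable_ex[where x = M]) (use neq ijl in simp)
  then show ?thesis unfolding entry_atom_def using assms(2) by simp
qed

text \<open>Variable 0 holds the bound, the odd variables hold one side of the position, the
  positive even ones the other. The move of a round is the coordinate \<open>r\<close>, stored in
  \<open>2 * r + 1\<close> or \<open>2 * r + 2\<close>.\<close>

lemma definable_game: "definable N (\<lambda>e. game n r (e 0) (\<lambda>s. e (2 * s + 1)) (\<lambda>s. e (2 * s + 2)))"
proof (induction n arbitrary: r)
  case 0
  \<comment> \<open>The coordinates below \<open>r\<close> occupy variables up to
    \<open>2 * r\<close>, so the three index variables from \<open>?m\<close> on are fresh.\<close>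
  let ?m = "2 * r + 3"
  have "definable N (\<lambda>e. \<forall>i j l. i \<prec> e 0 \<and> j \<prec> e 0 \<and> l \<prec> e 0 \<longrightarrow>
     (entry_atom c (map (\<lambda>s. e (2 * s + 1)) \<sigma>) i j l \<longleftrightarrow>
      entry_atom c (map (\<lambda>s. e (2 * s + 2)) \<sigma>) i j l))" if "c < 6" and \<sigma>: "\<sigma> \<in> six_tuples r" for c \<sigma>
  proof -
    define va where "va = map (\<lambda>s. 2 * s + 1) \<sigma>"
    define vb where "vb = map (\<lambda>s. 2 * s + 2) \<sigma>"
    have va: "map (\<lambda>s. e (2 * s + 1)) \<sigma> = map e va" and vb: "map (\<lambda>s. e (2 * s + 2)) \<sigma> = map e vb"
      for e :: "nat \<Rightarrow> 'a"
      by (simp_all add: va_def vb_def)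
    have len: "length va = 6" "length vb = 6" using \<sigma> by (simp_all add: va_def vb_def six_tuples_def)
    have upd: "map (e(x := a)) va = map e va" "map (e(x := a)) vb = map e vb" if "?m \<le> x" for e x a
      using that \<sigma> by (auto simp: va_def vb_def six_tuples_def)
    have "definable N (\<lambda>e. e ?m \<prec> e 0 \<and> e (Suc ?m) \<prec> e 0 \<and> e (Suc (Suc ?m)) \<prec> e 0 \<longrightarrow>
      (entry_atom c (map e va) (e ?m) (e (Suc ?m)) (e (Suc (Suc ?m))) \<longleftrightarrow>
       entry_atom c (map e vb) (e ?m) (e (Suc ?m)) (e (Suc (Suc ?m)))))"
      by (intro definable_and definable_imp definable_iff definable_entry_atom definable_var_less that(1) len)
    then have "definable N (\<lambda>e. \<forall>l. e ?m \<prec> e 0 \<and> e (Suc ?m) \<prec> e 0 \<and> l \<prec> e 0 \<longrightarrow>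
      (entry_atom c (map e va) (e ?m) (e (Suc ?m)) l \<longleftrightarrow> entry_atom c (map e vb) (e ?m) (e (Suc ?m)) l))"
      by (rule definable_all[where x = "Suc (Suc ?m)"]) (simp add: upd)
    then have "definable N (\<lambda>e. \<forall>j l. e ?m \<prec> e 0 \<and> j \<prec> e 0 \<and> l \<prec> e 0 \<longrightarrow>
      (entry_atom c (map e va) (e ?m) j l \<longleftrightarrow> entry_atom c (map e vb) (e ?m) j l))"
      by (rule definable_all[where x = "Suc ?m"]) (simp add: upd)
    then have "definable N (\<lambda>e. \<forall>i j l. i \<prec> e 0 \<and> j \<prec> e 0 \<and> l \<prec> e 0 \<longrightarrow>
      (entry_atom c (map e va) i j l \<longleftrightarrow> entry_atom c (map e vb) i j l))"
      by (rule definable_all[where x = ?m]) (simp add: upd)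
    then show ?thesis unfolding va vb .
  qed
  then show ?case
    unfolding game.simps by (intro definable_ball finite_six_tuples finite_lessThan) auto
next
  case (Suc n)
  let ?P = "\<lambda>e a b. game n (Suc r) (e 0) ((\<lambda>s. e (2 * s + 1))(r := a)) ((\<lambda>s. e (2 * s + 2))(r := b))"
  have parity: "2 * s + 1 = 2 * r + 1 \<longleftrightarrow> s = r" "2 * s + 2 = 2 * r + 2 \<longleftrightarrow> s = r"
    "2 * s + 1 \<noteq> 2 * r + 2" "2 * s + 2 \<noteq> 2 * r + 1" for s :: nat by presburger+
  have A: "(\<lambda>s. (e(2 * r + 1 := a)) (2 * s + 1)) = (\<lambda>s. e (2 * s + 1))(r := a)"
    "(\<lambda>s. (e(2 * r + 1 := a)) (2 * s + 2)) = (\<lambda>s. e (2 * s + 2))" for e :: "nat \<Rightarrow> 'a" and a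
    by (simp_all only: fun_eq_iff fun_upd_apply parity simp_thms if_False)
  have B: "(\<lambda>s. (e(2 * r + 2 := a)) (2 * s + 2)) = (\<lambda>s. e (2 * s + 2))(r := a)"
    "(\<lambda>s. (e(2 * r + 2 := a)) (2 * s + 1)) = (\<lambda>s. e (2 * s + 1))" for e :: "nat \<Rightarrow> 'a" and a
    by (simp_all only: fun_eq_iff fun_upd_apply parity simp_thms if_False)
  have 0: "(e(2 * r + 1 := a)) 0 = e 0" "(e(2 * r + 2 := a)) 0 = e 0" for e :: "nat \<Rightarrow> 'a" and a by simp_all
  have "definable N (\<lambda>e. \<exists>b. game n (Suc r) (e 0) (\<lambda>s. e (2 * s + 1)) ((\<lambda>s. e (2 * s + 2))(r := b)))"
    by (rule definable_ex[OF Suc.IH, where x = "2 * r + 2"]) (simp only: B 0)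
  then have 1: "definable N (\<lambda>e. \<forall>a. \<exists>b. ?P e a b)"
    by (rule definable_all[where x = "2 * r + 1"]) (simp only: A 0)
  have "definable N (\<lambda>e. \<exists>a. game n (Suc r) (e 0) ((\<lambda>s. e (2 * s + 1))(r := a)) (\<lambda>s. e (2 * s + 2)))"
    by (rule definable_ex[OF Suc.IH, where x = "2 * r + 1"]) (simp only: A 0)
  then have 2: "definable N (\<lambda>e. \<forall>b. \<exists>a. ?P e a b)"
    by (rule definable_all[where x = "2 * r + 2"]) (simp only: B 0)
  show ?case unfolding game.simps by (rule definable_and[OF 1 2])
qed

section \<open>Finitely many types at standard bounds, and overspill\<close>

text \<open>Below a standard bound there are finitely many indices, hence finitely many atomic
  types. For one more round, the type of a position is the set of types reachable by a move, a
  subset of a finite set.\<close>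

lemma game_finite_index:
  "\<exists>\<tau> :: (nat \<Rightarrow> 'a) \<Rightarrow> nat. finite (range \<tau>) \<and> (\<forall>A B. \<tau> A = \<tau> B \<longrightarrow> game n r (num m) A B)"
proof (induction n arbitrary: r)
  case 0
  let ?K = "{i. i \<prec> num m}"
  have K: "finite ?K" by (simp add: less_num_iff)
  define T where "T A = {(c, \<sigma>, i, j, l). c < 6 \<and> \<sigma> \<in> six_tuples r \<and> i \<prec> num m \<and> j \<prec> num m \<and>
    l \<prec> num m \<and> entry_atom c (map A \<sigma>) i j l}" for A
  have "range T \<subseteq> Pow ({..<6} \<times> six_tuples r \<times> ?K \<times> ?K \<times> ?K)" by (auto simp: T_def)
  then have fin: "finite (range T)"
    by (rule finite_subset) (simp add: finite_six_tuples K)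
  have "game 0 r (num m) A B" if "T A = T B" for A B
  proof -
    have "(c, \<sigma>, i, j, l) \<in> T A \<longleftrightarrow> (c, \<sigma>, i, j, l) \<in> T B" for c \<sigma> i j l using that by simp
    then show ?thesis unfolding T_def game.simps by blast
  qed
  then show ?case using finite_range_nat_code[OF fin] by metis
next
  case (Suc n)
  then obtain \<tau> :: "(nat \<Rightarrow> 'a) \<Rightarrow> nat" where \<tau>: "finite (range \<tau>)"
    "\<And>A B. \<tau> A = \<tau> B \<Longrightarrow> game n (Suc r) (num m) A B" by blast
  define T where "T A = range (\<lambda>a. \<tau> (A(r := a)))" for A
  have "range T \<subseteq> Pow (range \<tau>)" by (auto simp: T_def)
  then have fin: "finite (range T)" by (rule finite_subset) (simp add: \<tau>)
  have "game (Suc n) r (num m) A B" if "T A = T B" for A B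
    unfolding game.simps
  proof (intro conjI allI)
    fix a
    have "\<tau> (A(r := a)) \<in> T B" using that by (auto simp: T_def)
    then obtain b where "\<tau> (A(r := a)) = \<tau> (B(r := b))" by (auto simp: T_def)
    then show "\<exists>b. game n (Suc r) (num m) (A(r := a)) (B(r := b))" using \<tau>(2) by blast
  next
    fix b
    have "\<tau> (B(r := b)) \<in> T A" using that by (auto simp: T_def)
    then obtain a where "\<tau> (B(r := b)) = \<tau> (A(r := a))" by (auto simp: T_def)
    then show "\<exists>a. game n (Suc r) (num m) (A(r := a)) (B(r := b))" using \<tau>(2)[OF sym] by blast
  qed
  then show ?case using finite_range_nat_code[OF fin] by metis
qed

text \<open>At a standard bound an infinite model meets finitely many types, so two distinct
  elements share one. This statement is definable in the bound and overspills.\<close>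

lemma game_nonstandard:
  assumes "nonstandard N"
  obtains k A B where "k \<notin> range num" "A 0 \<noteq> B 0" "game n 1 k A B"
proof -
  let ?A = "\<lambda>(e :: nat \<Rightarrow> 'a) (s :: nat). e (2 * s + 1)" and ?B = "\<lambda>(e :: nat \<Rightarrow> 'a) (s :: nat). e (2 * s + 2)"
  let ?G = "\<lambda>e :: nat \<Rightarrow> 'a. e 1 \<noteq> e 2 \<and> game n 1 (e 0) (?A e) (?B e)"
  have def: "definable N ?G"
    by (intro definable_and definable_not definable_var_eq definable_game)
  have "definable N (\<lambda>e. \<exists>b. ?G (e(2 := b)))" by (rule definable_ex[OF def, where x = 2]) (rule refl)
  then have def: "definable N (\<lambda>e. \<exists>a b. ?G (e(1 := a, 2 := b)))"
    by (rule definable_ex[where x = 1]) (rule refl)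
  \<comment> \<open>The coordinates from 1 on are \<zero> on both sides; only coordinate 0 is on the
    board at the start.\<close>
  let ?e = "\<lambda>_ :: nat. \<zero>"
  have "\<exists>a b. ?G (?e(0 := num m, 1 := a, 2 := b))" for m
  proof -
    obtain \<tau> :: "(nat \<Rightarrow> 'a) \<Rightarrow> nat" where \<tau>: "finite (range \<tau>)"
      "\<And>A B. \<tau> A = \<tau> B \<Longrightarrow> game n 1 (num m) A B" using game_finite_index by blast
    let ?f = "\<lambda>a. \<tau> (?e(0 := a))"
    have "finite (range ?f)" by (rule finite_subset[OF _ \<tau>(1)]) auto
    then have "\<not> inj ?f" using infinite_model finite_imageD by blast
    then obtain a b where ab: "a \<noteq> b" "?f a = ?f b" by (auto simp: inj_def)
    have "?A (?e(0 := num m, 1 := a, 2 := b)) s = (?e(0 := a)) s" for s by (cases s) simp_all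
    then have "?A (?e(0 := num m, 1 := a, 2 := b)) = ?e(0 := a)" by (rule ext)
    moreover have "?B (?e(0 := num m, 1 := a, 2 := b)) s = (?e(0 := b)) s" for s by (cases s) simp_all
    then have "?B (?e(0 := num m, 1 := a, 2 := b)) = ?e(0 := b)" by (rule ext)
    moreover have "(?e(0 := num m, 1 := a, 2 := b)) 0 = num m" "(?e(0 := num m, 1 := a, 2 := b)) 1 = a"
      "(?e(0 := num m, 1 := a, 2 := b)) 2 = b" by simp_all
    ultimately have "?G (?e(0 := num m, 1 := a, 2 := b))" using ab(1) \<tau>(2)[OF ab(2)] by (simp only: simp_thms)
    then show ?thesis by (intro exI)
  qed
  from overspill[OF assms def this]
  obtain k where k: "k \<notin> range num" "\<exists>a b. ?G (?e(0 := k, 1 := a, 2 := b))" .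
  then obtain a b where "?G (?e(0 := k, 1 := a, 2 := b))" by (elim exE)
  then show thesis
    by (intro that[OF k(1), of "?A (?e(0 := k, 1 := a, 2 := b))" "?B (?e(0 := k, 1 := a, 2 := b))"]) simp_all
qed

section \<open>From the game to back-and-forth systems\<close>

definition corr :: "nat \<Rightarrow> (nat \<Rightarrow> 'a) \<Rightarrow> (nat \<Rightarrow> 'a) \<Rightarrow> 'a rel" where
  "corr r A B = {(u, v). \<exists>s<r. \<exists>s'<r. \<exists>i. entry (A s) (A s') (num i) u \<and> entry (B s) (B s') (num i) v}"

lemma corr_converse: "(corr r A B)\<inverse> = corr r B A"
  unfolding corr_def by blast

lemma corr_mono:
  assumes "r \<le> r'" "\<And>s. s < r \<Longrightarrow> A' s = A s" "\<And>s. s < r \<Longrightarrow> B' s = B s"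
  shows "corr r A B \<subseteq> corr r' A' B'"
proof (clarsimp simp: corr_def)
  fix u v s s' i
  assume "s < r" "s' < r" "entry (A s) (A s') (num i) u" "entry (B s) (B s') (num i) v"
  then show "\<exists>s<r'. \<exists>s'<r'. \<exists>i. entry (A' s) (A' s') (num i) u \<and> entry (B' s) (B' s') (num i) v"
    using assms by (intro exI[of _ s] conjI exI[of _ s'] exI[of _ i]) auto
qed

lemma entry_atom_iff:
  assumes "entry (xs ! 0) (xs ! 1) i u" "entry (xs ! 2) (xs ! 3) j v" "entry (xs ! 4) (xs ! 5) l w"
  shows "entry_atom c xs i j l \<longleftrightarrow> atom c u v w"
  unfolding entry_atom_def using assms entry_unique by metis

text \<open>All standard indices lie below the nonstandard \<open>k\<close>, so the winning
  condition covers them; since entries are unique, it speaks of the given elements.\<close>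

lemma game_0_partial_iso:
  assumes "game 0 r k A B" "k \<notin> range num"
  shows "partial_iso N (corr r A B)"
  unfolding partial_iso_def
proof (intro allI impI)
  fix u u' v v' w w'
  assume "(u, u') \<in> corr r A B" "(v, v') \<in> corr r A B" "(w, w') \<in> corr r A B"
  then obtain s s' i t t' j p p' l where
    r: "s < r" "s' < r" "t < r" "t' < r" "p < r" "p' < r" and
    A: "entry (A s) (A s') (num i) u" "entry (A t) (A t') (num j) v" "entry (A p) (A p') (num l) w" and
    B: "entry (B s) (B s') (num i) u'" "entry (B t) (B t') (num j) v'" "entry (B p) (B p') (num l) w'"
    unfolding corr_def by blast
  let ?\<sigma> = "[s, s', t, t', p, p']"
  have "?\<sigma> \<in> six_tuples r" using r by (simp add: six_tuples_def)
  then have "atom c u v w \<longleftrightarrow> atom c u' v' w'" if "c < 6" for c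
    using assms(1)[unfolded game.simps, rule_format, of c ?\<sigma> "num i" "num j" "num l"] that
      num_less_nonstandard[OF assms(2)] A B
      entry_atom_iff[of "map A ?\<sigma>" "num i" u "num j" v "num l" w c]
      entry_atom_iff[of "map B ?\<sigma>" "num i" u' "num j" v' "num l" w' c]
    by simp
  from this[of 0] this[of 1] this[of 2] this[of 3] this[of 4] this[of 5]
  show "(u = \<zero> \<longleftrightarrow> u' = \<zero>) \<and> (u = \<one> \<longleftrightarrow> u' = \<one>) \<and> (u = v \<longleftrightarrow> u' = v') \<and> (u \<prec> v \<longleftrightarrow> u' \<prec> v') \<and>
    (w = u \<oplus> v \<longleftrightarrow> w' = u' \<oplus> v') \<and> (w = u \<otimes> v \<longleftrightarrow> w' = u' \<otimes> v')"
    by (simp add: atom_def)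
qed

text \<open>The atom for equality, applied three times to the same code and index, says only that an
  entry exists there.\<close>

lemma game_0_entry:
  assumes "game 0 r k A B" "k \<notin> range num" "s < r" "s' < r" "entry (A s) (A s') (num i) u"
  shows "\<exists>v. entry (B s) (B s') (num i) v"
proof -
  let ?\<sigma> = "[s, s', s, s', s, s']"
  have "?\<sigma> \<in> six_tuples r" using assms by (simp add: six_tuples_def)
  moreover have "entry_atom 2 (map A ?\<sigma>) (num i) (num i) (num i)"
    unfolding entry_atom_def atom_def using assms(5) by auto
  ultimately have "entry_atom 2 (map B ?\<sigma>) (num i) (num i) (num i)"
    using assms(1)[unfolded game.simps, rule_format, of 2 ?\<sigma> "num i" "num i" "num i"]
      num_less_nonstandard[OF assms(2)] by simp
  then show ?thesis unfolding entry_atom_def by auto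
qed

text \<open>
  The first player picks the two components of a code of \<open>C\<close>, so a block of quantifiers of any
  standard length costs two rounds of the game.
\<close>

lemma game_forth:
  assumes "game (Suc (Suc n)) r k A B" "k \<notin> range num" "finite C"
  obtains A' B' where "game n (Suc (Suc r)) k A' B'" "corr r A B \<subseteq> corr (Suc (Suc r)) A' B'"
    "C \<subseteq> Domain (corr (Suc (Suc r)) A' B')"
proof -
  obtain cs where cs: "set cs = C" using assms(3) finite_list by blast
  obtain d x where x: "\<And>i. i < length cs \<Longrightarrow> entry x d (num i) (cs ! i)"
    using sequence_code[of cs] by blast
  obtain d' where "game (Suc n) (Suc r) k (A(r := d)) (B(r := d'))"
    using assms(1) by (metis game.simps(2))
  then obtain x' where g: "game n (Suc (Suc r)) k (A(r := d, Suc r := x)) (B(r := d', Suc r := x'))"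
    by (metis game.simps(2))
  define A' where "A' = A(r := d, Suc r := x)"
  define B' where "B' = B(r := d', Suc r := x')"
  have AB: "A' r = d" "A' (Suc r) = x" by (simp_all add: A'_def)
  have g: "game n (Suc (Suc r)) k A' B'" using g by (simp add: A'_def B'_def)
  have "corr r A B \<subseteq> corr (Suc (Suc r)) A' B'" by (rule corr_mono) (auto simp: A'_def B'_def)
  moreover have "C \<subseteq> Domain (corr (Suc (Suc r)) A' B')"
  proof
    fix c assume "c \<in> C"
    then obtain i where i: "i < length cs" "cs ! i = c" using cs by (auto simp: in_set_conv_nth)
    \<comment> \<open>In \<open>entry\<close> the dividend comes first; it was played second, whence
      \<open>Suc r\<close> before \<open>r\<close>.\<close>
    then have c: "entry (A' (Suc r)) (A' r) (num i) c" using x[of i] by (simp add: AB)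
    then obtain v where "entry (B' (Suc r)) (B' r) (num i) v"
      using game_0_entry[OF game_imp_game_0[OF g] assms(2), of "Suc r" r i c] by auto
    then have "(c, v) \<in> corr (Suc (Suc r)) A' B'"
      unfolding corr_def using c lessI[of "Suc r"] less_SucI[OF lessI[of r]] by blast
    then show "c \<in> Domain (corr (Suc (Suc r)) A' B')" by blast
  qed
  ultimately show thesis using that[OF g] by simp
qed

text \<open>Each rank costs two rounds. The back half is the forth half with the two sides of the
  position exchanged.\<close>

lemma game_back_forth:
  assumes "k \<notin> range num"
  shows "game (2 * n) r k A B \<Longrightarrow> back_forth N n (corr r A B)"
proof (induction n arbitrary: r A B)
  case 0
  then show ?case using game_0_partial_iso[OF _ assms, of r A B] by simp
next
  case (Suc n)
  have g: "game (Suc (Suc (2 * n))) r k A B" using Suc.prems by simp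
  show ?case
    unfolding back_forth.simps
  proof (intro allI impI conjI)
    fix C :: "'a set" assume C: "finite C"
    obtain A' B' where "game (2 * n) (Suc (Suc r)) k A' B'" "corr r A B \<subseteq> corr (Suc (Suc r)) A' B'"
      "C \<subseteq> Domain (corr (Suc (Suc r)) A' B')"
      using game_forth[OF g assms C] .
    then show "\<exists>R'. corr r A B \<subseteq> R' \<and> back_forth N n R' \<and> C \<subseteq> Domain R'"
      using Suc.IH by blast
    obtain A' B' where "game (2 * n) (Suc (Suc r)) k A' B'" "corr r B A \<subseteq> corr (Suc (Suc r)) A' B'"
      "C \<subseteq> Domain (corr (Suc (Suc r)) A' B')"
      using game_forth[OF iffD1[OF game_sym g] assms C] .
    then have "corr r A B \<subseteq> corr (Suc (Suc r)) B' A' \<and> back_forth N n (corr (Suc (Suc r)) B' A') \<and>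
        C \<subseteq> Range (corr (Suc (Suc r)) B' A')"
      using Suc.IH[of "Suc (Suc r)" B' A'] game_sym[of "2 * n" _ k A' B']
      unfolding corr_converse[of r B A, symmetric] corr_converse[of "Suc (Suc r)" A' B', symmetric] by blast
    then show "\<exists>R'. corr r A B \<subseteq> R' \<and> back_forth N n R' \<and> C \<subseteq> Range R'" by blast
  qed
qed

text \<open>Each starting element is the entry at index 0 of the code formed from itself, so the
  starting relation contains the pair.\<close>

lemma indistinguishable_elements:
  assumes "nonstandard N"
  obtains a b R where "a \<noteq> b" "(a, b) \<in> R" "back_forth N n R"
proof -
  obtain k A B where k: "k \<notin> range num" "A 0 \<noteq> B 0" "game (2 * n) 1 k A B"
    using game_nonstandard[OF assms] .
  have "(A 0, B 0) \<in> corr 1 A B"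
    unfolding corr_def using entry_self[of "A 0"] entry_self[of "B 0"] by (auto intro!: exI[of _ "0 :: nat"])
  then show thesis using that[OF k(2)] game_back_forth[OF k(1,3)] by blast
qed

end

section \<open>Prime models of Peano arithmetic\<close>

text \<open>The Tarski-Vaught test. The submodel on \<open>B\<close> is copied to the natural
  numbers by an enumeration, because \<open>prime_model\<close> speaks of structures on that
  type.\<close>

lemma elementary_nat_submodel:
  fixes M :: "'a arith"
  assumes B: "countable B" "infinite B"
    and witness: "\<forall>e x p c. (\<forall>i. e i \<in> B) \<and> sat M (e(x := c)) p \<longrightarrow> (\<exists>a\<in>B. sat M (e(x := a)) p)"
  shows "\<exists>(M' :: nat arith) g. elementary_embedding g M' M \<and> range g \<subseteq> B"
proof -
  have wit: "\<exists>a\<in>B. sat M (e(x := a)) p" if "\<And>i. e i \<in> B" "sat M (e(x := c)) p" for e x p c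
    using witness that by blast
  define g where "g = from_nat_into B"
  define h where "h = to_nat_on B"
  have g: "g i \<in> B" for i
    unfolding g_def using B(2) by (metis finite.emptyI from_nat_into)
  have gh: "g (h b) = b" if "b \<in> B" for b
    unfolding g_def h_def using B(1) that by simp
  have inj: "g i = g j \<longleftrightarrow> i = j" for i j
    unfolding g_def using B by (simp add: from_nat_into_inj_infinite)
  have tB: "tmval M e t \<in> B" if e: "\<And>i. e i \<in> B" for e t
  proof -
    obtain x where x: "x \<notin> tmvars t"
      using finite_tmvars[of t] ex_new_if_finite infinite_UNIV_nat by blast
    have t: "tmval M (e(x := a)) t = tmval M e t" for a
      by (rule tmval_cong) (use x in auto)
    \<comment> \<open>Closure under terms is itself an instance of the witness condition.\<close>
    have "\<exists>a\<in>B. sat M (e(x := a)) (FEq (TVar x) t)"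
      by (rule wit[OF e, where c = "tmval M e t"]) (simp add: t)
    then show ?thesis by (simp add: t)
  qed
  define M' where "M' = \<lparr>zro = h (zro M), uno = h (uno M),
    add = (\<lambda>i j. h (add M (g i) (g j))), mul = (\<lambda>i j. h (mul M (g i) (g j))),
    lss = (\<lambda>i j. lss M (g i) (g j))\<rparr>"
  have zB: "zro M \<in> B" "uno M \<in> B"
    using tB[of g TZero] tB[of g TOne] g by simp_all
  have opB: "add M a b \<in> B" "mul M a b \<in> B" if "a \<in> B" "b \<in> B" for a b
    using tB[of "\<lambda>i. if i = 0 then a else b" "TAdd (TVar 0) (TVar 1)"]
      tB[of "\<lambda>i. if i = 0 then a else b" "TMul (TVar 0) (TVar 1)"] that by auto
  have tm: "g (tmval M' e t) = tmval M (g \<circ> e) t" for e t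
    by (induction t) (simp_all add: M'_def gh zB opB tB g)
  have "sat M' e p \<longleftrightarrow> sat M (g \<circ> e) p" for e p
  proof (induction p arbitrary: e)
    case (FEq s t)
    show ?case by (simp only: sat.simps tm[symmetric] inj)
  next
    case (FLt s t)
    show ?case by (simp only: sat.simps tm[symmetric]) (simp add: M'_def)
  next
    case (FEx x p)
    have upd: "g \<circ> e(x := i) = (g \<circ> e)(x := g i)" for i by auto
    have "(\<exists>i. sat M ((g \<circ> e)(x := g i)) p) \<longleftrightarrow> (\<exists>a. sat M ((g \<circ> e)(x := a)) p)"
    proof
      assume "\<exists>a. sat M ((g \<circ> e)(x := a)) p"
      then obtain a where "a \<in> B" "sat M ((g \<circ> e)(x := a)) p" using wit[of "g \<circ> e" x _ p] g by auto
      then show "\<exists>i. sat M ((g \<circ> e)(x := g i)) p" using gh by metis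
    qed blast
    then show ?case by (simp only: sat.simps FEx.IH upd)
  qed auto
  then have "elementary_embedding g M' M \<and> range g \<subseteq> B"
    using g unfolding elementary_embedding_def by blast
  then show ?thesis by (intro exI)
qed

section \<open>Definable elements\<close>

definition definable_elements :: "'a arith \<Rightarrow> 'a set" where
  "definable_elements N = {a. \<forall>x. definable N (\<lambda>e. e x = a)}"

lemma definable_substitute:
  assumes "definable N P" "a \<in> definable_elements N"
  shows "definable N (\<lambda>e. P (e(x := a)))"
proof -
  have "definable N (\<lambda>e. P e \<and> e x = a)"
    using assms by (intro definable_and) (auto simp: definable_elements_def)
  then have "definable N (\<lambda>e. \<exists>b. P (e(x := b)) \<and> b = a)"
    by (rule definable_ex[where x = x]) simp
  then show ?thesis by simp
qed

text \<open>Definable parameters are eliminated from a formula, one variable at a time.\<close>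

lemma definable_override:
  assumes "finite F" "definable N P" "\<And>i. f i \<in> definable_elements N"
  shows "definable N (\<lambda>e. P (override_on e f F))"
  using assms(1)
proof (induction F)
  case (insert v F)
  have ov: "override_on (e(v := f v)) f F = override_on e f (insert v F)" for e
    using insert.hyps by (auto simp: override_on_def)
  show ?case using definable_substitute[OF insert.IH assms(3), of v v] by (simp only: ov)
qed (use assms(2) in simp)

text \<open>A formula defining \<open>b\<close> has the same truth value at \<open>a\<close> and at
  \<open>f a\<close>. Taking \<open>b\<close> to be whichever of the two is definable forces them to
  agree.\<close>

lemma definable_elements_fixed:
  assumes "elementary_embedding f N N" and "f a \<in> definable_elements N \<or> a \<in> definable_elements N"
  shows "f a = a"
proof -
  have *: "a = b \<longleftrightarrow> f a = b" if "b \<in> definable_elements N" for b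
  proof -
    have "definable N (\<lambda>e. e 0 = b)" using that by (simp add: definable_elements_def)
    then obtain p where p: "\<And>e. sat N e p \<longleftrightarrow> e 0 = b" unfolding definable_def by blast
    have "sat N (\<lambda>_. a) p \<longleftrightarrow> sat N (f \<circ> (\<lambda>_. a)) p"
      using assms(1) unfolding elementary_embedding_def by blast
    then show ?thesis by (simp add: p)
  qed
  show ?thesis using assms(2) *[of a] *[of "f a"] by metis
qed

lemma isomorphism_elementary:
  assumes "isomorphism f M N"
  shows "elementary_embedding f M N"
proof -
  have f: "bij f" "f (zro M) = zro N" "f (uno M) = uno N" "\<And>x y. f (add M x y) = add N (f x) (f y)"
    "\<And>x y. f (mul M x y) = mul N (f x) (f y)" "\<And>x y. lss M x y \<longleftrightarrow> lss N (f x) (f y)"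
    using assms by (simp_all add: isomorphism_def)
  have tm: "tmval N (f \<circ> e) t = f (tmval M e t)" for e t
    by (induction t) (simp_all add: f)
  have "sat M e p \<longleftrightarrow> sat N (f \<circ> e) p" for e p
  proof (induction p arbitrary: e)
    case (FEq s t)
    show ?case by (simp only: sat.simps tm inj_eq[OF bij_is_inj[OF f(1)]])
  next
    case (FLt s t)
    show ?case by (simp only: sat.simps tm f(6))
  next
    case (FEx x p)
    have upd: "f \<circ> e(x := a) = (f \<circ> e)(x := f a)" for a by auto
    have "(\<exists>a. sat N ((f \<circ> e)(x := f a)) p) \<longleftrightarrow> (\<exists>b. sat N ((f \<circ> e)(x := b)) p)"
      using bij_is_surj[OF f(1)] by (metis surjD)
    then show ?case by (simp only: sat.simps FEx.IH upd)
  qed simp_all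
  then show ?thesis by (simp add: elementary_embedding_def)
qed

context peano
begin

text \<open>The least witness is definable: the parameters are definable and can be eliminated, and
  leastness is first-order.\<close>

lemma definable_elements_witness:
  assumes e: "\<And>i. e i \<in> definable_elements N" and "sat N (e(x := c)) p"
  shows "\<exists>a\<in>definable_elements N. sat N (e(x := a)) p"
proof -
  define Q where "Q z \<longleftrightarrow> sat N (e(x := z)) p" for z
  obtain a where a: "Q a" "\<And>z. z \<prec> a \<Longrightarrow> \<not> Q z"
    using least_element[OF definable_sat assms(2)] unfolding Q_def by blast
  have "definable N (\<lambda>e'. sat N (override_on e' e (fv p - {x})) p)"
    by (rule definable_override[OF _ definable_sat e]) (simp add: finite_fv)
  moreover have "sat N (override_on e' e (fv p - {x})) p \<longleftrightarrow> Q (e' x)" for e'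
    unfolding Q_def by (rule sat_cong) (auto simp: override_on_def)
  ultimately have x: "definable N (\<lambda>e'. Q (e' x))" by simp
  have Q: "definable N (\<lambda>e'. Q (e' y))" for y
  proof (cases "y = x")
    case False
    \<comment> \<open>Renames the variable \<open>x\<close> to \<open>y\<close> by an intermediate
      element.\<close>
    have "definable N (\<lambda>e'. \<exists>b. Q b \<and> b = e' y)"
      by (rule definable_ex[OF definable_and[OF x definable_var_eq[of N x y]], where x = x])
        (use False in simp)
    then show ?thesis by simp
  qed (use x in simp)
  have "definable N (\<lambda>e'. e' y = a)" for y
  proof -
    have "definable N (\<lambda>e'. \<forall>z. z \<prec> e' y \<longrightarrow> \<not> Q z)"
      by (rule definable_all[OF definable_imp[OF definable_var_less[of N "Suc y" y] definable_not[OF Q[of "Suc y"]]],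
            where x = "Suc y"]) simp
    then have "definable N (\<lambda>e'. Q (e' y) \<and> (\<forall>z. z \<prec> e' y \<longrightarrow> \<not> Q z))"
      by (intro definable_and Q)
    moreover have "Q b \<and> (\<forall>z. z \<prec> b \<longrightarrow> \<not> Q z) \<longleftrightarrow> b = a" for b
      using a less_linear[of a b] by blast
    ultimately show ?thesis by simp
  qed
  then show ?thesis using a(1) by (auto simp: definable_elements_def Q_def)
qed

lemma num_definable: "num i \<in> definable_elements N"
proof (induction i)
  case 0
  show ?case using definable_eq[of N "TVar x" TZero for x] by (simp add: definable_elements_def)
next
  case (Suc i)
  have "definable N (\<lambda>e. e x = num i \<oplus> \<one>)" for x
    using definable_substitute[OF definable_eq[of N "TVar x" "TAdd (TVar (Suc x)) TOne"] Suc, of "Suc x"]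
    by simp
  then show ?case by (simp add: definable_elements_def)
qed

text \<open>The embedding into the submodel of definable elements, followed by the inclusion, is an
  elementary self-map with definable values. It fixes every element, so every element is one of
  these values.\<close>

lemma prime_model_definable:
  assumes "countable (UNIV :: 'a set)" "prime_model N"
  shows "a \<in> definable_elements N"
proof -
  have "range num \<subseteq> definable_elements N" using num_definable by auto
  moreover have "infinite (range num)"
    using num_eq_iff by (intro range_inj_infinite injI) simp
  ultimately have inf: "infinite (definable_elements N)" using finite_subset by blast
  have cnt: "countable (definable_elements N)" using countable_subset[OF subset_UNIV assms(1)] .
  have "\<exists>(M' :: nat arith) g. elementary_embedding g M' N \<and> range g \<subseteq> definable_elements N"
    using definable_elements_witness by (intro elementary_nat_submodel[OF cnt inf] allI impI) blast
  then obtain M' :: "nat arith" and g where g: "elementary_embedding g M' N"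
    "range g \<subseteq> definable_elements N" by (elim exE conjE)
  have range: "g i \<in> definable_elements N" for i using g(2) by blast
  have "models M' (complete_theory N)"
    using g(1) unfolding models_def complete_theory_def elementary_embedding_def by simp
  then obtain f where f: "elementary_embedding f N M'" using assms(2) unfolding prime_model_def by blast
  have "sat N e p \<longleftrightarrow> sat N (g \<circ> f \<circ> e) p" for e p
    using f[unfolded elementary_embedding_def, rule_format, of e p]
      g(1)[unfolded elementary_embedding_def, rule_format, of "f \<circ> e" p]
    by (simp only: comp_assoc)
  then have gf: "elementary_embedding (g \<circ> f) N N"
    unfolding elementary_embedding_def by blast
  have "(g \<circ> f) a = a" by (rule definable_elements_fixed[OF gf]) (simp add: range)
  then show ?thesis using range[of "f a"] by simp
qed

section \<open>Orbits and the Scott rank of a prime model\<close>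

lemma prime_model_orbit:
  assumes "countable (UNIV :: 'a set)" "prime_model N"
  shows "automorphism_orbit N as = {as}"
proof -
  have "f a = a" if "isomorphism f N N" for f a
    using definable_elements_fixed[OF isomorphism_elementary[OF that]] prime_model_definable[OF assms]
    by blast
  then have "map f as = as" if "isomorphism f N N" for f using that by (simp add: map_idI)
  moreover have "isomorphism id N N" by (simp add: isomorphism_def)
  moreover have "map id as = as" by simp
  ultimately show ?thesis unfolding automorphism_orbit_def by (intro equalityI subsetI) (auto, metis)
qed

lemma prime_model_orbits_Sigma_omega:
  assumes "countable (UNIV :: 'a set)" "prime_model N"
  shows "orbits_Sigma_definable N \<omega>"
  unfolding orbits_Sigma_definable_def
proof
  fix as :: "'a list"
  let ?V = "{..<length as}"
  have "definable N (\<lambda>e. \<forall>i\<in>?V. e i = as ! i)"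
    using prime_model_definable[OF assms] by (intro definable_ball) (auto simp: definable_elements_def)
  then obtain p where p: "\<And>e. sat N e p \<longleftrightarrow> (\<forall>i\<in>?V. e i = as ! i)" "fv p \<subseteq> ?V"
    by (rule definable_formula_vars[where V = ?V]) auto
  obtain q where q: "Sigma_in \<omega> q" "ifv q \<subseteq> fv p" "\<And>e. isat N q e \<longleftrightarrow> sat N e p"
    using finitary_expressible_omega[of N p] unfolding expressible_def by blast
  have "map e [0..<length as] = as \<longleftrightarrow> (\<forall>i\<in>?V. e i = as ! i)" for e
    using list_eq_iff_nth_eq[of "map e [0..<length as]" as] by auto
  then have "map e [0..<length as] \<in> automorphism_orbit N as \<longleftrightarrow> isat N q e" for e
    by (simp only: prime_model_orbit[OF assms] q(3) p(1) singleton_iff)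
  then show "Sigma_definable N \<omega> (length as) (automorphism_orbit N as)"
    unfolding Sigma_definable_def using q(1,2) p(2) by blast
qed

text \<open>As orbits are singletons, a definition of the orbit of \<open>[a]\<close> separates
  \<open>a\<close> from every other element; but two distinct elements related by a system of rank
  \<open>Suc n\<close> agree on all formulas of level \<open>n\<close>.\<close>

lemma prime_model_orbits_not_Sigma_fin:
  assumes "countable (UNIV :: 'a set)" "prime_model N" "nonstandard N"
  shows "\<not> orbits_Sigma_definable N (fin_ord n)"
proof
  assume orbits: "orbits_Sigma_definable N (fin_ord n)"
  obtain a b R where ab: "a \<noteq> b" "(a, b) \<in> R" "back_forth N (Suc n) R"
    using indistinguishable_elements[OF assms(3)] .
  have "Sigma_definable N (fin_ord n) 1 {[a]}"
    using orbits prime_model_orbit[OF assms(1,2), of "[a]"]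
    unfolding orbits_Sigma_definable_def by (metis One_nat_def length_Cons list.size(3))
  then obtain p where p: "Sigma_in (fin_ord n) p" "\<And>e. map e [0..<1] \<in> {[a]} \<longleftrightarrow> isat N p e"
    unfolding Sigma_definable_def by blast
  have "isat N p (\<lambda>_. a) \<longleftrightarrow> isat N p (\<lambda>_. b)"
    using back_forth_Sigma_Pi[OF disjI1[OF p(1)] ab(3), of "\<lambda>_. a" "\<lambda>_. b"] ab(2) by blast
  then show False using ab(1) by (simp add: p(2)[symmetric])
qed

end

theorem theorem1p5:
  fixes N :: "'a arith"
  assumes "countable (UNIV :: 'a set)"
    and "models_PA N"
    and "nonstandard N"
    and "prime_model N"
  shows "is_scott_rank N \<omega>"
proof -
  interpret peano N by unfold_locales (rule assms(2))
  \<comment> \<open>Every ordinal below \<omega> is some \<open>fin_ord n\<close>, so minimality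
    concerns finite levels only.\<close>
  have "\<omega> \<le> \<beta>" if "orbits_Sigma_definable N \<beta>" for \<beta>
    using that prime_model_orbits_not_Sigma_fin[OF assms(1,4,3)] less_omega_iff by (metis not_less)
  then show ?thesis
    unfolding is_scott_rank_def using prime_model_orbits_Sigma_omega[OF assms(1,4)] by blast
qed

end
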